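(* Let $a:\mathbf{R}^N\to(0,\infty)$ be a $C^1$ function and let $H$ be the Friedrichs extension in $L^2(\mathbf{R}^N,\mathrm{d}^Nx)$ of the non-negative symmetric operator $H_0f=-\nabla\cdot(a\nabla f)$, $f\in C_c^\infty(\mathbf{R}^N)$. If there exists a constant $c>0$ such that $c\le a(x)<\infty$ for all $x\in\mathbf{R}^N$, then for every $\alpha>0$ the operator $A=(H+\alpha I)^{-1}$ satisfies $$\lim_{s\to0}\|U_sA-A\|=0,\qquad \lim_{s\to0}\|U_sA^*-A^*\|=0.$$
   Context: For $s\in\mathbf{R}^N$, $U_s$ is the unitary translation operator on $L^2(\mathbf{R}^N)$ given by $(U_sf)(x)=f(x+s)$. The norm is the operator norm. The Friedrichs extension $H$ is the non-negative self-adjoint operator associated with the closure of the (closable) quadratic form $Q_0(f)=\int_{\mathbf{R}^N}a(x)|\nabla f(x)|^2\,\mathrm{d}^Nx$ defined on $C_c^\infty(\mathbf{R}^N)$. *)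

theory Defs
  imports "HOL-Analysis.Analysis"
begin

section \<open>The complex Hilbert space \<open>L\<^sup>2(\<real>\<^sup>N)\<close>\<close>

definition sq_integrable :: "(real^'n \<Rightarrow> complex) \<Rightarrow> bool" where
  "sq_integrable f \<longleftrightarrow>
     f \<in> borel_measurable lborel \<and> integrable lborel (\<lambda>x. (cmod (f x))\<^sup>2)"

definition l2_eq :: "(real^'n \<Rightarrow> complex) \<Rightarrow> (real^'n \<Rightarrow> complex) \<Rightarrow> bool" where
  "l2_eq f g \<longleftrightarrow> sq_integrable f \<and> sq_integrable g \<and> (AE x in lborel. f x = g x)"

lemma sq_integrable_mult:
  assumes "sq_integrable f" "sq_integrable g"
  shows "integrable lborel (\<lambda>x. f x * cnj (g x))"
proof (rule Bochner_Integration.integrable_bound)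
  show "integrable lborel (\<lambda>x. (cmod (f x))\<^sup>2 + (cmod (g x))\<^sup>2)"
    using assms by (auto simp: sq_integrable_def)
  show "(\<lambda>x. f x * cnj (g x)) \<in> borel_measurable lborel"
    using assms by (auto simp: sq_integrable_def intro!: borel_measurable_times
        borel_measurable_continuous_on[where f=cnj, OF continuous_on_cnj[OF continuous_on_id]])
  have "cmod (f x) * cmod (g x) \<le> (cmod (f x))\<^sup>2 + (cmod (g x))\<^sup>2" for x
  proof -
    have "2 * cmod (f x) * cmod (g x) \<le> (cmod (f x))\<^sup>2 + (cmod (g x))\<^sup>2"
      by (rule sum_squares_bound)
    moreover have "0 \<le> cmod (f x) * cmod (g x)" by simp
    ultimately show ?thesis by linarith
  qed
  then show "AE x in lborel. norm (f x * cnj (g x))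
      \<le> norm ((cmod (f x))\<^sup>2 + (cmod (g x))\<^sup>2)"
    by (simp add: norm_mult)
qed

lemma sq_integrable_zero: "sq_integrable (\<lambda>x. 0)"
  by (simp add: sq_integrable_def)

lemma sq_integrable_scale:
  assumes "sq_integrable f" shows "sq_integrable (\<lambda>x. c * f x)"
  using assms by (auto simp: sq_integrable_def norm_mult power_mult_distrib)

lemma sq_integrable_add:
  assumes "sq_integrable f" "sq_integrable g"
  shows "sq_integrable (\<lambda>x. f x + g x)"
  unfolding sq_integrable_def
proof
  show "(\<lambda>x. f x + g x) \<in> borel_measurable lborel"
    using assms by (auto simp: sq_integrable_def)
  show "integrable lborel (\<lambda>x. (cmod (f x + g x))\<^sup>2)"
  proof (rule Bochner_Integration.integrable_bound)
    show "integrable lborel (\<lambda>x. 2 * (cmod (f x))\<^sup>2 + 2 * (cmod (g x))\<^sup>2)"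
      using assms by (auto simp: sq_integrable_def)
    show "(\<lambda>x. (cmod (f x + g x))\<^sup>2) \<in> borel_measurable lborel"
      using assms by (auto simp: sq_integrable_def)
    have "(cmod (f x + g x))\<^sup>2 \<le> 2 * (cmod (f x))\<^sup>2 + 2 * (cmod (g x))\<^sup>2" for x
    proof -
      have "(cmod (f x + g x))\<^sup>2 \<le> (cmod (f x) + cmod (g x))\<^sup>2"
        by (rule power_mono[OF norm_triangle_ineq]) simp
      also have "\<dots> \<le> 2 * (cmod (f x))\<^sup>2 + 2 * (cmod (g x))\<^sup>2"
        using sum_squares_bound[of "cmod (f x)" "cmod (g x)"] by (simp add: power2_sum)
      finally show ?thesis .
    qed
    then show "AE x in lborel. norm ((cmod (f x + g x))\<^sup>2)
        \<le> norm (2 * (cmod (f x))\<^sup>2 + 2 * (cmod (g x))\<^sup>2)"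
      by simp
  qed
qed

quotient_type (overloaded) 'n l2 = "real^('n::finite) \<Rightarrow> complex" / partial: l2_eq
  morphisms rep_l2 abs_l2
proof (rule part_equivpI)
  show "\<exists>f. l2_eq f f"
    by (rule exI[of _ "\<lambda>x. 0"]) (simp add: l2_eq_def sq_integrable_zero)
  show "symp l2_eq"
    by (auto simp: symp_def l2_eq_def elim: AE_mp)
  show "transp l2_eq"
    unfolding transp_def l2_eq_def by (auto elim!: eventually_elim2)
qed

lift_definition cinner_l2 :: "'n::finite l2 \<Rightarrow> 'n l2 \<Rightarrow> complex"
  is "\<lambda>f g. \<integral>x. f x * cnj (g x) \<partial>lborel"
proof -
  fix f f' g g' :: "real^'n \<Rightarrow> complex"
  assume 1: "l2_eq f f'" and 2: "l2_eq g g'"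
  then have "AE x in lborel. f x * cnj (g x) = f' x * cnj (g' x)"
    by (auto simp: l2_eq_def elim!: eventually_elim2)
  moreover have "integrable lborel (\<lambda>x. f x * cnj (g x))"
    "integrable lborel (\<lambda>x. f' x * cnj (g' x))"
    using 1 2 by (auto simp: l2_eq_def intro: sq_integrable_mult)
  ultimately show "(\<integral>x. f x * cnj (g x) \<partial>lborel) = (\<integral>x. f' x * cnj (g' x) \<partial>lborel)"
    by (intro integral_cong_AE) auto
qed

instantiation l2 :: (finite) real_inner
begin

lift_definition zero_l2 :: "'a l2" is "\<lambda>x. 0"
  by (simp add: l2_eq_def sq_integrable_zero)

lift_definition plus_l2 :: "'a l2 \<Rightarrow> 'a l2 \<Rightarrow> 'a l2" is "\<lambda>f g x. f x + g x"
  by (auto simp: l2_eq_def intro: sq_integrable_add elim!: eventually_elim2)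

lift_definition uminus_l2 :: "'a l2 \<Rightarrow> 'a l2" is "\<lambda>f x. - f x"
  by (auto simp: l2_eq_def sq_integrable_def elim!: eventually_mono)

definition minus_l2 :: "'a l2 \<Rightarrow> 'a l2 \<Rightarrow> 'a l2" where
  "minus_l2 u v = u + - v"

lift_definition scaleR_l2 :: "real \<Rightarrow> 'a l2 \<Rightarrow> 'a l2" is "\<lambda>r f x. of_real r * f x"
  by (auto simp: l2_eq_def intro: sq_integrable_scale elim!: eventually_mono)

definition inner_l2 :: "'a l2 \<Rightarrow> 'a l2 \<Rightarrow> real" where
  "inner_l2 u v = Re (cinner_l2 u v)"

definition norm_l2 :: "'a l2 \<Rightarrow> real" where
  "norm_l2 u = sqrt (inner u u)"

definition sgn_l2 :: "'a l2 \<Rightarrow> 'a l2" where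
  "sgn_l2 u = inverse (norm u) *\<^sub>R u"

definition dist_l2 :: "'a l2 \<Rightarrow> 'a l2 \<Rightarrow> real" where
  "dist_l2 u v = norm (u - v)"

definition uniformity_l2 :: "('a l2 \<times> 'a l2) filter" where
  "uniformity_l2 = (INF e\<in>{0<..}. principal {(x, y). dist x y < e})"

definition open_l2 :: "'a l2 set \<Rightarrow> bool" where
  "open_l2 S \<longleftrightarrow> (\<forall>x\<in>S. \<forall>\<^sub>F (x', y) in uniformity. x' = x \<longrightarrow> y \<in> S)"

instance
proof
  fix u v w :: "'a l2" and r t :: real
  show "u + v + w = u + (v + w)"
    by transfer (auto simp: l2_eq_def add.assoc intro!: sq_integrable_add)
  show "u + v = v + u"
    by transfer (auto simp: l2_eq_def add.commute intro!: sq_integrable_add)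
  show "0 + u = u"
    by transfer (auto simp: l2_eq_def)
  show "- u + u = 0"
    by transfer (auto simp: l2_eq_def sq_integrable_zero)
  show "u - v = u + - v"
    by (rule minus_l2_def)
  show "r *\<^sub>R (u + v) = r *\<^sub>R u + r *\<^sub>R v"
    by transfer (auto simp: l2_eq_def ring_distribs
        intro!: sq_integrable_add sq_integrable_scale)
  show "(r + t) *\<^sub>R u = r *\<^sub>R u + t *\<^sub>R u"
    by transfer (auto simp: l2_eq_def ring_distribs
        intro!: sq_integrable_add sq_integrable_scale)
  show "r *\<^sub>R t *\<^sub>R u = (r * t) *\<^sub>R u"
    by transfer (auto simp: l2_eq_def mult.assoc intro!: sq_integrable_scale)
  show "1 *\<^sub>R u = u"
    by transfer (auto simp: l2_eq_def)
  show "dist u v = norm (u - v)"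
    by (rule dist_l2_def)
  show "sgn u = inverse (norm u) *\<^sub>R u"
    by (rule sgn_l2_def)
  show "(uniformity :: ('a l2 \<times> 'a l2) filter)
      = (INF e\<in>{0<..}. principal {(x, y). dist x y < e})"
    by (rule uniformity_l2_def)
  show "open S \<longleftrightarrow> (\<forall>x\<in>S. \<forall>\<^sub>F (x', y) in uniformity. x' = x \<longrightarrow> y \<in> S)"
    for S :: "'a l2 set"
    by (rule open_l2_def)
  have "cinner_l2 v u = cnj (cinner_l2 u v)"
    by transfer (simp add: Bochner_Integration.integral_cnj[symmetric] mult.commute
        del: Bochner_Integration.integral_cnj)
  then show "inner u v = inner v u"
    by (simp add: inner_l2_def)
  have "cinner_l2 (u + v) w = cinner_l2 u w + cinner_l2 v w"
    by transfer (simp add: ring_distribs sq_integrable_mult l2_eq_def)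
  then show "inner (u + v) w = inner u w + inner v w"
    by (simp add: inner_l2_def)
  have "cinner_l2 (r *\<^sub>R u) v = of_real r * cinner_l2 u v"
    by transfer (simp add: mult.assoc)
  then show "inner (r *\<^sub>R u) v = r * inner u v"
    by (simp add: inner_l2_def)
  have cc: "(\<lambda>x. f x * cnj (f x)) = (\<lambda>x. complex_of_real ((cmod (f x))\<^sup>2))"
    for f :: "real^'a \<Rightarrow> complex"
    by (intro ext) (rule complex_norm_square[symmetric])
  have sq: "Re (\<integral>x. f x * cnj (f x) \<partial>lborel) = (\<integral>x. (cmod (f x))\<^sup>2 \<partial>lborel)"
    for f :: "real^'a \<Rightarrow> complex"
    unfolding cc integral_complex_of_real by simp
  show "0 \<le> inner u u"
    unfolding inner_l2_def by transfer (simp only: sq, simp)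
  show "inner u u = 0 \<longleftrightarrow> u = 0"
    unfolding inner_l2_def
  proof (transfer, unfold sq)
    fix f :: "real^'a \<Rightarrow> complex"
    assume "l2_eq f f"
    then have f: "sq_integrable f" by (simp add: l2_eq_def)
    then have "(\<integral>x. (cmod (f x))\<^sup>2 \<partial>lborel) = 0 \<longleftrightarrow> (AE x in lborel. (cmod (f x))\<^sup>2 = 0)"
      by (intro integral_nonneg_eq_0_iff_AE) (auto simp: sq_integrable_def)
    then show "(\<integral>x. (cmod (f x))\<^sup>2 \<partial>lborel) = 0 \<longleftrightarrow> l2_eq f (\<lambda>x. 0)"
      using f by (simp add: l2_eq_def sq_integrable_zero)
  qed
  show "norm u = sqrt (inner u u)"
    by (rule norm_l2_def)
qed

end

lemma lborel_translate_AE: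
  fixes s :: "real^'n"
  assumes "f \<in> borel_measurable lborel" "g \<in> borel_measurable lborel"
    and "AE x in lborel. f x = (g x :: complex)"
  shows "AE x in lborel. f (x + s) = g (x + s)"
proof -
  have "AE x in distr lborel borel ((+) s). f x = g x"
    using assms(3) by (subst lborel_distr_plus)
  then have "AE x in lborel. f (s + x) = g (s + x)"
    using assms(1,2) by (subst (asm) AE_distr_iff) auto
  then show ?thesis by (simp add: add.commute)
qed

lemma sq_integrable_translate:
  assumes "sq_integrable f"
  shows "sq_integrable (\<lambda>x. f (x + s))"
proof -
  have f: "f \<in> borel_measurable borel" "integrable lborel (\<lambda>x. (cmod (f x))\<^sup>2)"
    using assms by (auto simp: sq_integrable_def)
  have "integrable (distr lborel borel ((+) s)) (\<lambda>x. (cmod (f x))\<^sup>2)"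
    using f(2) by (simp add: lborel_distr_plus)
  then have "integrable lborel (\<lambda>x. (cmod (f (s + x)))\<^sup>2)"
    using f(1) by (subst (asm) integrable_distr_eq) auto
  moreover have "(\<lambda>x. f (x + s)) \<in> borel_measurable borel"
    by (rule measurable_compose[OF _ f(1)]) simp
  ultimately show ?thesis
    by (simp add: sq_integrable_def add.commute)
qed

lift_definition translate_l2 :: "real^'n::finite \<Rightarrow> 'n l2 \<Rightarrow> 'n l2"
  is "\<lambda>s f x. f (x + s)"
  unfolding l2_eq_def
  by (intro conjI sq_integrable_translate lborel_translate_AE) (auto simp: sq_integrable_def)

text \<open>The adjoint with respect to the complex inner product; it is unique if it exists.\<close>

definition adjoint_l2 :: "('n::finite l2 \<Rightarrow> 'n l2) \<Rightarrow> ('n l2 \<Rightarrow> 'n l2)" where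
  "adjoint_l2 A = (THE B. \<forall>f g. cinner_l2 (A f) g = cinner_l2 f (B g))"


section \<open>Unbounded operators and sesquilinear forms\<close>

text \<open>Unbounded operators in \<open>L\<^sup>2\<close> are represented by their graphs.\<close>

type_synonym 'n l2_op = "('n l2 \<times> 'n l2) set"

definition plus_scalar :: "'n::finite l2_op \<Rightarrow> real \<Rightarrow> 'n l2_op" where
  "plus_scalar T \<alpha> = {(u, h + \<alpha> *\<^sub>R u) | u h. (u, h) \<in> T}"

definition is_bounded_inverse :: "'n::finite l2_op \<Rightarrow> ('n l2 \<Rightarrow> 'n l2) \<Rightarrow> bool" where
  "is_bounded_inverse T A \<longleftrightarrow> bounded_linear A \<and> (\<forall>u f. (u, f) \<in> T \<longleftrightarrow> u = A f)"

definition op_inverse :: "'n::finite l2_op \<Rightarrow> 'n l2 \<Rightarrow> 'n l2" where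
  "op_inverse T f = (THE u. (u, f) \<in> T)"

text \<open>
  A form is a domain \<open>D\<close> together with a sesquilinear map \<open>q\<close>
  (linear in the first argument), of which only the values on \<open>D\<close> matter.
  The closure of a non-negative closable form has as its domain the \<open>L\<^sup>2\<close>-limits of
  \<open>q\<close>-Cauchy sequences in \<open>D\<close>, and its value is the limit of the values
  along approximating sequences; closability is what makes that limit independent of the
  sequences chosen.
\<close>

definition form_approx ::
  "'n::finite l2 set \<Rightarrow> ('n l2 \<Rightarrow> 'n l2 \<Rightarrow> complex) \<Rightarrow> (nat \<Rightarrow> 'n l2) \<Rightarrow> 'n l2 \<Rightarrow> bool" where
  "form_approx D q \<phi> u \<longleftrightarrow>
     (\<forall>n. \<phi> n \<in> D) \<and> \<phi> \<longlonglongrightarrow> u \<and>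
     (\<forall>e>0. \<exists>M. \<forall>m\<ge>M. \<forall>n\<ge>M. cmod (q (\<phi> m - \<phi> n) (\<phi> m - \<phi> n)) < e)"

definition closure_dom ::
  "'n::finite l2 set \<Rightarrow> ('n l2 \<Rightarrow> 'n l2 \<Rightarrow> complex) \<Rightarrow> 'n l2 set" where
  "closure_dom D q = {u. \<exists>\<phi>. form_approx D q \<phi> u}"

definition closure_form ::
  "'n::finite l2 set \<Rightarrow> ('n l2 \<Rightarrow> 'n l2 \<Rightarrow> complex) \<Rightarrow> 'n l2 \<Rightarrow> 'n l2 \<Rightarrow> complex" where
  "closure_form D q u v =
     (THE c. \<forall>\<phi> \<psi>. form_approx D q \<phi> u \<longrightarrow> form_approx D q \<psi> v \<longrightarrow>
        (\<lambda>n. q (\<phi> n) (\<psi> n)) \<longlonglongrightarrow> c)"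

text \<open>The operator associated with a closed form (first representation theorem).\<close>

definition form_operator ::
  "'n::finite l2 set \<Rightarrow> ('n l2 \<Rightarrow> 'n l2 \<Rightarrow> complex) \<Rightarrow> 'n l2_op" where
  "form_operator D q = {(u, h). u \<in> D \<and> (\<forall>v\<in>D. q u v = cinner_l2 h v)}"


section \<open>Test functions\<close>

definition partial_deriv ::
  "'n::finite \<Rightarrow> (real^'n \<Rightarrow> 'b::real_normed_vector) \<Rightarrow> real^'n \<Rightarrow> 'b" where
  "partial_deriv i f x = frechet_derivative f (at x) (axis i 1)"

primrec C_k :: "nat \<Rightarrow> (real^'n::finite \<Rightarrow> 'b::real_normed_vector) \<Rightarrow> bool" where
  "C_k 0 f \<longleftrightarrow> continuous_on UNIV f"
| "C_k (Suc k) f \<longleftrightarrow>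
     (\<forall>x. f differentiable (at x)) \<and> (\<forall>i. C_k k (partial_deriv i f))"

definition test_function :: "(real^'n::finite \<Rightarrow> complex) \<Rightarrow> bool" where
  "test_function f \<longleftrightarrow> (\<forall>k. C_k k f) \<and> compact (closure {x. f x \<noteq> 0})"

definition test_l2 :: "'n::finite l2 set" where
  "test_l2 = abs_l2 ` {f. test_function f}"

text \<open>A class in \<open>L\<^sup>2\<close> contains at most one test function, see \<open>test_rep_abs_l2\<close> below.\<close>

definition test_rep :: "'n::finite l2 \<Rightarrow> (real^'n \<Rightarrow> complex)" where
  "test_rep u = (THE f. test_function f \<and> abs_l2 f = u)"

lemma test_function_continuous:
  assumes "test_function f" shows "continuous_on UNIV f"
  using assms C_k.simps(1) unfolding test_function_def by blast

lemma test_function_sq_integrable: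
  assumes "test_function f" shows "sq_integrable f"
proof -
  let ?K = "closure {x. f x \<noteq> 0}"
  have c: "continuous_on UNIV f" and K: "compact ?K"
    using assms test_function_continuous by (auto simp: test_function_def)
  have "integrable lborel (\<lambda>x. indicator ?K x *\<^sub>R (cmod (f x))\<^sup>2)"
    by (rule borel_integrable_compact[OF K])
      (intro continuous_intros continuous_on_subset[OF c] subset_UNIV)
  also have "(\<lambda>x. indicator ?K x *\<^sub>R (cmod (f x))\<^sup>2) = (\<lambda>x. (cmod (f x))\<^sup>2)"
    using closure_subset[of "{x. f x \<noteq> 0}"] by (intro ext) (auto simp: indicator_def)
  finally show ?thesis
    using c by (auto simp: sq_integrable_def borel_measurable_continuous_onI)
qed

lemma continuous_AE_eq:
  fixes f g :: "real^'n \<Rightarrow> complex"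
  assumes "continuous_on UNIV f" "continuous_on UNIV g" "AE x in lborel. f x = g x"
  shows "f = g"
proof (rule ccontr)
  assume ne: "f \<noteq> g"
  have op: "open {x. f x \<noteq> g x}"
    by (rule open_Collect_neq[OF assms(1,2)])
  have "{x \<in> space lborel. \<not> f x = g x} \<in> sets lborel"
    using op by simp
  then have "emeasure lborel {x. f x \<noteq> g x} = 0"
    using AE_iff_measurable[OF _ refl, of lborel "\<lambda>x. f x = g x"] assms(3) by simp
  then have "negligible {x. f x \<noteq> g x}"
    using op by (simp add: negligible_iff_null_sets null_sets_def)
  then show False
    using open_not_negligible[OF op] ne by auto
qed

lemma test_rep_abs_l2:
  assumes "test_function f" shows "test_rep (abs_l2 f) = f"
  unfolding test_rep_def
proof (rule the_equality)
  show "test_function f \<and> abs_l2 f = abs_l2 f" using assms by simp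
  fix g assume g: "test_function g \<and> abs_l2 g = abs_l2 f"
  then have "l2_eq g f"
    using assms test_function_sq_integrable Quotient_rel_abs2
    by (metis (mono_tags, lifting) AE_I2 Quotient_l2 Quotient_rel l2_eq_def)
  then show "g = f"
    using g assms by (auto simp: l2_eq_def intro: continuous_AE_eq test_function_continuous)
qed


section \<open>The Friedrichs extension of \<open>-\<nabla>\<cdot>(a\<nabla>)\<close>\<close>

text \<open>
  The sesquilinear form whose diagonal is \<open>\<integral> a |\<nabla>f|\<^sup>2\<close>; on test functions it is the
  pairing of \<open>-\<nabla>\<cdot>(a\<nabla>f)\<close> with \<open>g\<close>. The Friedrichs extension is the operator
  associated with its closure.
\<close>

definition dirichlet_form ::
  "(real^'n::finite \<Rightarrow> real) \<Rightarrow> (real^'n \<Rightarrow> complex) \<Rightarrow> (real^'n \<Rightarrow> complex) \<Rightarrow> complex" where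
  "dirichlet_form a f g =
     (\<integral>x. of_real (a x) * (\<Sum>i\<in>UNIV. partial_deriv i f x * cnj (partial_deriv i g x)) \<partial>lborel)"

lemma dirichlet_form_diag:
  "dirichlet_form a f f =
     of_real (\<integral>x. a x * (\<Sum>i\<in>UNIV. (cmod (partial_deriv i f x))\<^sup>2) \<partial>lborel)"
  unfolding dirichlet_form_def
  by (simp add: complex_norm_square[symmetric] integral_complex_of_real[symmetric]
      del: integral_complex_of_real of_real_power)

definition dirichlet_l2 ::
  "(real^'n::finite \<Rightarrow> real) \<Rightarrow> 'n l2 \<Rightarrow> 'n l2 \<Rightarrow> complex" where
  "dirichlet_l2 a u v = dirichlet_form a (test_rep u) (test_rep v)"

definition friedrichs :: "(real^'n::finite \<Rightarrow> real) \<Rightarrow> 'n l2_op" where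
  "friedrichs a =
     form_operator (closure_dom test_l2 (dirichlet_l2 a)) (closure_form test_l2 (dirichlet_l2 a))"

end

theory Submission
  imports Defs
begin

text \<open>
  The resolvent maps into the domain of the closed form, which is a space of functions with
  square-integrable gradient, and translations are Lipschitz on such functions. For a test
  function \<open>\<phi>\<close>, \<open>\<parallel>U\<^sub>s \<phi> - \<phi>\<parallel> \<le> |s| \<parallel>\<nabla>\<phi>\<parallel> \<le> |s| sqrt (Q(\<phi>) / c)\<close> because \<open>a \<ge> c\<close>
  (\<open>norm_translate_diff_le_dirichlet\<close>), and this passes to the closure. Testing the resolvent equation
  for \<open>u = A f\<close> with \<open>u\<close> itself gives \<open>Q(u) + \<alpha> \<parallel>u\<parallel>\<^sup>2 = Re \<langle>f, u\<rangle>\<close>, hence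
  \<open>Q(A f) \<le> \<parallel>f\<parallel>\<^sup>2 / \<alpha>\<close> (\<open>resolvent_bounds\<close>). Together, \<open>\<parallel>U\<^sub>s A - A\<parallel> \<le> |s| / sqrt (c \<alpha>)\<close>. The
  operator \<open>A\<close> is self-adjoint (\<open>adjoint_resolvent\<close>), so the claim on the adjoint is the same claim.

  The rest is the existence of \<open>A\<close>, that is, the representation theorem for the closed form. It needs
  three ingredients. The space \<open>L\<^sup>2\<close> is complete (\<open>l2_Cauchy_convergent\<close>). The Dirichlet form is
  closable because on test functions it is given by the symmetric operator \<open>-\<nabla>\<cdot>(a\<nabla>)\<close>
  (\<open>dirichlet_form_green\<close>, \<open>form_approx_zero\<close>); here the \<open>C\<^sup>1\<close> regularity of \<open>a\<close> enters. And the resolvent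
  equation is solved by minimising the energy functional over the test functions
  (\<open>resolvent_eq_exists\<close>): a minimising sequence is Cauchy for the form, so it is itself an
  approximating sequence of the solution, and everything about the closed form can be read off
  from sequences in the core.

  Both facts about test functions, integration by parts and the translation estimate, come from the
  same source: difference quotients with step \<open>1 / (n + 1)\<close> converge pointwise to the directional
  derivative under a common integrable bound, so their integrals and their \<open>L\<^sup>2\<close> norms converge.
\<close>

section \<open>The Hilbert space of square-integrable classes\<close>

lemma sq_integrable_rep_l2: "sq_integrable (rep_l2 u)"
  using Quotient_rep_reflp[OF Quotient_l2, of u] by (simp add: l2_eq_def)

lemma abs_rep_l2: "abs_l2 (rep_l2 u) = u"
  by (rule Quotient_abs_rep[OF Quotient_l2])

lemma l2_eq_refl: "sq_integrable f \<Longrightarrow> l2_eq f f"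
  by (simp add: l2_eq_def)

lemma abs_l2_add:
  "sq_integrable f \<Longrightarrow> sq_integrable g \<Longrightarrow> abs_l2 f + abs_l2 g = abs_l2 (\<lambda>x. f x + g x)"
  by (rule plus_l2.abs_eq) (auto intro: l2_eq_refl)

lemma sq_integrable_diff:
  assumes "sq_integrable f" "sq_integrable g"
  shows "sq_integrable (\<lambda>x. f x - g x)"
  using sq_integrable_add[OF assms(1) sq_integrable_scale[OF assms(2), of "-1"]] by simp

lemma abs_l2_diff:
  assumes "sq_integrable f" "sq_integrable g"
  shows "abs_l2 f - abs_l2 g = abs_l2 (\<lambda>x. f x - g x)"
proof -
  have "abs_l2 (\<lambda>x. f x - g x) + abs_l2 g = abs_l2 f"
    using abs_l2_add[OF sq_integrable_diff[OF assms] assms(2)] by simp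
  then show ?thesis by (metis add_diff_cancel)
qed

lemma abs_l2_scaleR:
  "sq_integrable f \<Longrightarrow> r *\<^sub>R abs_l2 f = abs_l2 (\<lambda>x. of_real r * f x)"
  by (rule scaleR_l2.abs_eq) (auto intro: l2_eq_refl)

lemma cinner_abs_l2:
  "sq_integrable f \<Longrightarrow> sq_integrable g \<Longrightarrow>
    cinner_l2 (abs_l2 f) (abs_l2 g) = (\<integral>x. f x * cnj (g x) \<partial>lborel)"
  by (rule cinner_l2.abs_eq) (auto intro: l2_eq_refl)

lemma norm_abs_l2:
  assumes "sq_integrable f"
  shows "(norm (abs_l2 f))\<^sup>2 = (\<integral>x. (cmod (f x))\<^sup>2 \<partial>lborel)"
proof -
  have "(norm (abs_l2 f))\<^sup>2 = Re (\<integral>x. complex_of_real ((cmod (f x))\<^sup>2) \<partial>lborel)"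
    unfolding power2_norm_eq_inner[of "abs_l2 f"] inner_l2_def cinner_abs_l2[OF assms assms]
    by (simp only: complex_norm_square)
  then show ?thesis by (simp only: integral_complex_of_real Re_complex_of_real)
qed

text \<open>Complex scalars recover the imaginary part of an identity from the real part, which is all that
  the real inner product and a real variational argument provide.\<close>

lift_definition scaleC_l2 :: "complex \<Rightarrow> 'n::finite l2 \<Rightarrow> 'n l2"
  is "\<lambda>c f x. c * f x"
  by (auto simp: l2_eq_def intro: sq_integrable_scale elim!: eventually_mono)

lemma abs_l2_scaleC:
  "sq_integrable f \<Longrightarrow> scaleC_l2 c (abs_l2 f) = abs_l2 (\<lambda>x. c * f x)"
  by (rule scaleC_l2.abs_eq) (auto intro: l2_eq_refl)

lemma scaleC_l2_of_real: "scaleC_l2 (of_real r) u = r *\<^sub>R u"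
  by transfer (auto simp: l2_eq_def intro: sq_integrable_scale)

lemma cinner_l2_commute: "cinner_l2 v u = cnj (cinner_l2 u v)"
  by transfer (simp add: Bochner_Integration.integral_cnj[symmetric] mult.commute
        del: Bochner_Integration.integral_cnj)

lemma cinner_l2_add_left: "cinner_l2 (u + v) w = cinner_l2 u w + cinner_l2 v w"
  by transfer (simp add: ring_distribs sq_integrable_mult l2_eq_def)

lemma cinner_l2_add_right: "cinner_l2 w (u + v) = cinner_l2 w u + cinner_l2 w v"
  by (metis cinner_l2_add_left cinner_l2_commute complex_cnj_add)

lemma cinner_l2_scaleC_left: "cinner_l2 (scaleC_l2 c u) v = c * cinner_l2 u v"
  by transfer (simp add: mult.assoc)

lemma cinner_l2_scaleC_right: "cinner_l2 u (scaleC_l2 c v) = cnj c * cinner_l2 u v"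
  by (metis cinner_l2_commute cinner_l2_scaleC_left complex_cnj_mult)

lemma Re_cinner_l2_self: "Re (cinner_l2 u u) = (norm u)\<^sup>2"
  by (simp add: power2_norm_eq_inner inner_l2_def)

lemma cinner_l2_self: "cinner_l2 u u = of_real ((norm u)\<^sup>2)"
proof -
  have "Im (cinner_l2 u u) = 0"
    using cinner_l2_commute[of u u] by (metis cnj.sel(2) equal_neg_zero)
  then show ?thesis by (simp add: complex_eq_iff Re_cinner_l2_self)
qed

lemma norm_scaleC_l2: "norm (scaleC_l2 c u) = cmod c * norm u"
proof -
  have "complex_of_real ((norm (scaleC_l2 c u))\<^sup>2) = c * cnj c * cinner_l2 u u"
    by (simp only: cinner_l2_self[symmetric] cinner_l2_scaleC_left cinner_l2_scaleC_right ac_simps)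
  also have "\<dots> = of_real ((cmod c * norm u)\<^sup>2)"
    by (simp only: complex_norm_square[symmetric] cinner_l2_self of_real_mult[symmetric]
        power_mult_distrib)
  finally have "(norm (scaleC_l2 c u))\<^sup>2 = (cmod c * norm u)\<^sup>2"
    by (simp only: of_real_eq_iff)
  then show ?thesis by (simp add: power2_eq_iff_nonneg)
qed

text \<open>The real Cauchy-Schwarz inequality only controls the real part; rotating \<open>u\<close> by a phase
  makes the complex inner product real.\<close>

lemma cmod_cinner_l2_le: "cmod (cinner_l2 u v) \<le> norm u * norm v"
proof (cases "cinner_l2 u v = 0")
  case False
  define c where "c = cnj (sgn (cinner_l2 u v))"
  have c: "cmod c = 1" using False by (simp add: c_def norm_sgn)
  have "c * cinner_l2 u v = of_real (cmod (cinner_l2 u v))"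
  proof -
    have "cnj z * z = of_real (cmod z) * of_real (cmod z)" for z :: complex
      by (metis complex_norm_square mult.commute power2_eq_square of_real_mult)
    then show ?thesis using False
      by (simp add: c_def sgn_div_norm scaleR_conv_of_real field_simps)
  qed
  then have "cmod (cinner_l2 u v) = inner (scaleC_l2 c u) v"
    by (simp add: inner_l2_def cinner_l2_scaleC_left)
  also have "\<dots> \<le> norm (scaleC_l2 c u) * norm v" by (rule norm_cauchy_schwarz)
  finally show ?thesis using c by (simp add: norm_scaleC_l2)
qed simp

interpretation cinner_l2: bounded_bilinear cinner_l2
proof
  fix u v w :: "'n::finite l2" and r :: real
  show "cinner_l2 (u + v) w = cinner_l2 u w + cinner_l2 v w" by (rule cinner_l2_add_left)
  show "cinner_l2 w (u + v) = cinner_l2 w u + cinner_l2 w v" by (rule cinner_l2_add_right)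
  show "cinner_l2 (r *\<^sub>R u) v = r *\<^sub>R cinner_l2 u v"
    by (simp add: scaleC_l2_of_real[symmetric] cinner_l2_scaleC_left scaleR_conv_of_real)
  show "cinner_l2 u (r *\<^sub>R v) = r *\<^sub>R cinner_l2 u v"
    by (simp add: scaleC_l2_of_real[symmetric] cinner_l2_scaleC_right scaleR_conv_of_real)
  show "\<exists>K. \<forall>u v :: 'n l2. norm (cinner_l2 u v) \<le> norm u * norm v * K"
    by (intro exI[of _ 1] allI) (simp add: cmod_cinner_l2_le)
qed

lemma bounded_linear_scaleC_l2:
  "bounded_linear (scaleC_l2 c :: 'n::finite l2 \<Rightarrow> 'n l2)"
proof (rule bounded_linear_intro[where K="cmod c"])
  fix u v :: "'n::finite l2" and r :: real
  show "scaleC_l2 c (u + v) = scaleC_l2 c u + scaleC_l2 c v"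
    by transfer (auto simp: l2_eq_def ring_distribs intro!: sq_integrable_add sq_integrable_scale)
  show "scaleC_l2 c (r *\<^sub>R u) = r *\<^sub>R scaleC_l2 c u"
    by transfer (auto simp: l2_eq_def mult.left_commute intro!: sq_integrable_scale)
  show "norm (scaleC_l2 c u) \<le> norm u * cmod c"
    by (simp add: norm_scaleC_l2 mult.commute)
qed

lemma cinner_l2_ext:
  assumes "\<And>f. cinner_l2 f u = cinner_l2 f v"
  shows "u = v"
proof -
  have "cinner_l2 (u - v) (u - v) = 0"
    using assms[of "u - v"] by (simp add: cinner_l2.diff_right)
  then show ?thesis by (simp add: cinner_l2_self)
qed

lemma translate_abs_l2:
  "sq_integrable f \<Longrightarrow> translate_l2 s (abs_l2 f) = abs_l2 (\<lambda>x. f (x + s))"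
  by (rule translate_l2.abs_eq) (auto intro: l2_eq_refl)

lemma lborel_integral_translate:
  fixes f :: "real^'n \<Rightarrow> 'b::{banach, second_countable_topology}"
  assumes "f \<in> borel_measurable borel"
  shows "(\<integral>x. f (x + s) \<partial>lborel) = (\<integral>x. f x \<partial>lborel)"
proof -
  have "(\<integral>x. f x \<partial>distr lborel borel ((+) s)) = (\<integral>x. f (s + x) \<partial>lborel)"
    by (rule integral_distr) (use assms in auto)
  then show ?thesis by (simp add: lborel_distr_plus add.commute)
qed

lemma norm_translate_l2: "norm (translate_l2 s u) = norm u"
proof -
  let ?f = "rep_l2 u"
  have "(norm (translate_l2 s (abs_l2 ?f)))\<^sup>2 = (norm (abs_l2 ?f))\<^sup>2"
    unfolding translate_abs_l2[OF sq_integrable_rep_l2]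
      norm_abs_l2[OF sq_integrable_rep_l2] norm_abs_l2[OF sq_integrable_translate[OF sq_integrable_rep_l2]]
    by (rule lborel_integral_translate[where f="\<lambda>x. (cmod (?f x))\<^sup>2"])
      (use sq_integrable_rep_l2[of u] in \<open>auto simp: sq_integrable_def\<close>)
  then show ?thesis by (simp add: abs_rep_l2 power2_eq_iff_nonneg)
qed

lemma bounded_linear_translate_l2: "bounded_linear (translate_l2 (s :: real^'n::finite))"
proof (rule bounded_linear_intro[where K=1])
  fix u v :: "'n::finite l2" and r :: real
  show "translate_l2 s (u + v) = translate_l2 s u + translate_l2 s v"
    by transfer (auto simp: l2_eq_def intro!: sq_integrable_add sq_integrable_translate)
  show "translate_l2 s (r *\<^sub>R u) = r *\<^sub>R translate_l2 s u"
    by transfer (auto simp: l2_eq_def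
        intro!: sq_integrable_scale sq_integrable_translate)
  show "norm (translate_l2 s u) \<le> norm u * 1"
    by (simp add: norm_translate_l2)
qed

lemma translate_l2_add: "translate_l2 s (translate_l2 t u) = translate_l2 (s + t) u"
proof -
  let ?f = "rep_l2 u"
  have "translate_l2 s (translate_l2 t (abs_l2 ?f)) = translate_l2 (s + t) (abs_l2 ?f)"
    by (simp add: translate_abs_l2 sq_integrable_translate sq_integrable_rep_l2 add.assoc)
  then show ?thesis by (simp add: abs_rep_l2)
qed

text \<open>Riesz-Fischer. Along a subsequence with consecutive distances at most \<open>2 ^ - n\<close>, the bound
  \<open>2 * t \<le> 2 ^ n * t\<^sup>2 + 2 ^ - n\<close> turns summability of the squared norms into almost everywhere
  summability of the increments, and Fatou's lemma carries the Cauchy estimate over to the pointwise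
  limit.\<close>

theorem l2_Cauchy_convergent:
  fixes X :: "nat \<Rightarrow> 'n::finite l2"
  assumes "Cauchy X"
  shows "convergent X"
proof -
  have "\<forall>n. \<exists>N. \<forall>m\<ge>N. \<forall>k\<ge>N. norm (X m - X k) < (1/2)^n"
    using assms by (auto simp: Cauchy_iff)
  then obtain N where N: "\<And>n m k. m \<ge> N n \<Longrightarrow> k \<ge> N n \<Longrightarrow> norm (X m - X k) < (1/2)^n"
    by metis
  \<comment> \<open>partial sums of the thresholds make the choice of indices strictly increasing\<close>
  define r where "r n = n + (\<Sum>i\<le>n. N i)" for n
  have rSuc: "r n < r (Suc n)" for n by (simp add: r_def)
  have sm: "strict_mono r" by (rule strict_mono_Suc_iff[THEN iffD2]) (use rSuc in blast)
  have rN: "r n \<ge> N n" for n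
  proof -
    have "N n \<le> (\<Sum>i\<le>n. N i)" by (rule member_le_sum) auto
    then show ?thesis by (simp add: r_def)
  qed
  have near: "norm (X (r m) - X (r n)) < (1/2)^n" if "m \<ge> n" for m n
    using N[of n "r m" "r n"] rN[of n] strict_mono_leD[OF sm that] by linarith
  define f where "f n = rep_l2 (X (r n))" for n
  have fsq: "sq_integrable (f n)" for n by (simp add: f_def sq_integrable_rep_l2)
  have fX: "abs_l2 (f n) = X (r n)" for n by (simp add: f_def abs_rep_l2)
  have fm [measurable]: "f n \<in> borel_measurable lborel" for n
    using fsq by (simp add: sq_integrable_def)
  have nn: "(\<integral>\<^sup>+x. ennreal ((cmod (f m x - f n x))\<^sup>2) \<partial>lborel) \<le> ennreal ((1/4)^n)"
    if "m \<ge> n" for m n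
  proof -
    have sq: "sq_integrable (\<lambda>x. f m x - f n x)" by (rule sq_integrable_diff[OF fsq fsq])
    have "(\<integral>\<^sup>+x. ennreal ((cmod (f m x - f n x))\<^sup>2) \<partial>lborel)
        = ennreal (\<integral>x. (cmod (f m x - f n x))\<^sup>2 \<partial>lborel)"
      by (rule nn_integral_eq_integral) (use sq in \<open>auto simp: sq_integrable_def\<close>)
    also have "(\<integral>x. (cmod (f m x - f n x))\<^sup>2 \<partial>lborel) = (norm (X (r m) - X (r n)))\<^sup>2"
      using norm_abs_l2[OF sq] abs_l2_diff[OF fsq fsq, of m n] by (simp add: fX)
    also have "\<dots> \<le> ((1/2)^n)\<^sup>2"
      by (rule power_mono) (use near[OF that] in auto)
    also have "((1/2::real)^n)\<^sup>2 = (1/4)^n"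
      by (simp add: power_mult[symmetric] mult.commute[of n]) (simp add: power_mult power2_eq_square)
    finally show ?thesis by (simp add: ennreal_leI)
  qed
  have "(\<integral>\<^sup>+x. (\<Sum>n. ennreal (2^n * (cmod (f (Suc n) x - f n x))\<^sup>2)) \<partial>lborel)
      = (\<Sum>n. \<integral>\<^sup>+x. ennreal (2^n * (cmod (f (Suc n) x - f n x))\<^sup>2) \<partial>lborel)"
    by (rule nn_integral_suminf) measurable
  also have "\<dots> \<le> (\<Sum>n. ennreal ((1/2)^n))"
  proof (rule suminf_le)
    fix n
    have "(\<integral>\<^sup>+x. ennreal (2^n * (cmod (f (Suc n) x - f n x))\<^sup>2) \<partial>lborel)
        = ennreal (2^n) * (\<integral>\<^sup>+x. ennreal ((cmod (f (Suc n) x - f n x))\<^sup>2) \<partial>lborel)"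
      by (subst nn_integral_cmult[symmetric]) (auto simp: ennreal_mult)
    also have "\<dots> \<le> ennreal (2^n) * ennreal ((1/4)^n)"
      by (intro mult_left_mono nn) auto
    also have "\<dots> = ennreal ((1/2)^n)"
      by (simp add: ennreal_mult[symmetric] power_mult_distrib[symmetric])
    finally show "(\<integral>\<^sup>+x. ennreal (2^n * (cmod (f (Suc n) x - f n x))\<^sup>2) \<partial>lborel)
        \<le> ennreal ((1/2)^n)" .
  qed auto
  also have "\<dots> < \<infinity>"
  proof -
    have "(\<Sum>n. ennreal ((1/2)^n)) \<noteq> top"
      by (rule ennreal_suminf_neq_top) (auto intro: summable_geometric)
    then show ?thesis by (simp only: less_top infinity_ennreal_def)
  qed
  finally have "AE x in lborel. (\<Sum>n. ennreal (2^n * (cmod (f (Suc n) x - f n x))\<^sup>2)) \<noteq> \<infinity>"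
    by (intro nn_integral_noteq_infinite) auto
  then have conv: "AE x in lborel. convergent (\<lambda>n. f n x)"
  proof eventually_elim
    case (elim x)
    have s1: "summable (\<lambda>n. 2^n * (cmod (f (Suc n) x - f n x))\<^sup>2)"
      by (rule summable_suminf_not_top) (use elim in auto)
    have "summable (\<lambda>n. 2^n * (cmod (f (Suc n) x - f n x))\<^sup>2 + (1/2)^n)"
      by (intro summable_add s1 summable_geometric) simp
    then have "summable (\<lambda>n. f (Suc n) x - f n x)"
    proof (rule summable_comparison_test')
      fix n :: nat
      define t where "t = cmod (f (Suc n) x - f n x)"
      have p: "(0::real) < 2^n" by simp
      have "0 \<le> (2^n * t - 1)\<^sup>2 / 2^n" by simp
      also have "\<dots> = 2^n * t\<^sup>2 - 2 * t + (1/2)^n"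
        using p by (simp add: power2_diff power_mult_distrib field_simps power2_eq_square)
      finally have "2 * t \<le> 2^n * t\<^sup>2 + (1/2)^n" by simp
      moreover have "0 \<le> t" by (simp add: t_def)
      ultimately show "norm (f (Suc n) x - f n x) \<le> 2^n * (cmod (f (Suc n) x - f n x))\<^sup>2 + (1/2)^n"
        by (simp add: t_def[symmetric])
    qed
    then have "convergent (\<lambda>n. \<Sum>k<n. f (Suc k) x - f k x)"
      by (simp add: summable_iff_convergent)
    then have "convergent (\<lambda>n. f n x - f 0 x)"
      by (simp only: sum_lessThan_telescope[where f="\<lambda>k. f k x"])
    then have "convergent (\<lambda>n. (f n x - f 0 x) + f 0 x)"
      by (rule convergent_add) (rule convergent_const)
    then show ?case by simp
  qed
  define F where "F x = lim (\<lambda>n. f n x)" for x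
  have Fm [measurable]: "F \<in> borel_measurable lborel"
    unfolding F_def by (rule borel_measurable_lim_metric) (use fm in auto)
  have lim: "AE x in lborel. (\<lambda>n. f n x) \<longlonglongrightarrow> F x"
    using conv by eventually_elim (simp add: F_def convergent_LIMSEQ_iff)
  have Ffn: "(\<integral>\<^sup>+x. ennreal ((cmod (F x - f n x))\<^sup>2) \<partial>lborel) \<le> ennreal ((1/4)^n)" for n
  proof -
    have "(\<integral>\<^sup>+x. ennreal ((cmod (F x - f n x))\<^sup>2) \<partial>lborel)
        = (\<integral>\<^sup>+x. liminf (\<lambda>m. ennreal ((cmod (f m x - f n x))\<^sup>2)) \<partial>lborel)"
    proof (rule nn_integral_cong_AE, use lim in eventually_elim)
      case (elim x)
      have "(\<lambda>m. ennreal ((cmod (f m x - f n x))\<^sup>2)) \<longlonglongrightarrow> ennreal ((cmod (F x - f n x))\<^sup>2)"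
        by (intro tendsto_ennrealI tendsto_intros elim)
      then show ?case by (rule lim_imp_Liminf[OF trivial_limit_sequentially, symmetric])
    qed
    also have "\<dots> \<le> liminf (\<lambda>m. \<integral>\<^sup>+x. ennreal ((cmod (f m x - f n x))\<^sup>2) \<partial>lborel)"
      by (rule nn_integral_liminf) auto
    also have "\<dots> \<le> liminf (\<lambda>m. ennreal ((1/4)^n))"
      by (rule Liminf_mono) (use nn in \<open>auto simp: eventually_sequentially\<close>)
    also have "\<dots> = ennreal ((1/4)^n)" by (rule Liminf_const) simp
    finally show ?thesis .
  qed
  have dsq: "sq_integrable (\<lambda>x. F x - f n x)" for n
  proof -
    have "(\<integral>\<^sup>+x. ennreal ((cmod (F x - f n x))\<^sup>2) \<partial>lborel) < \<infinity>"
      using Ffn[of n] by (rule le_less_trans) simp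
    then have "integrable lborel (\<lambda>x. (cmod (F x - f n x))\<^sup>2)"
      by (intro integrableI_nonneg) auto
    then show ?thesis by (simp add: sq_integrable_def)
  qed
  have Fsq: "sq_integrable F"
    using sq_integrable_add[OF dsq[of 0] fsq[of 0]] by simp
  have "norm (X (r n) - abs_l2 F) \<le> (1/2)^n" for n
  proof -
    have "ennreal ((norm (abs_l2 F - X (r n)))\<^sup>2)
        = (\<integral>\<^sup>+x. ennreal ((cmod (F x - f n x))\<^sup>2) \<partial>lborel)"
      unfolding fX[symmetric] abs_l2_diff[OF Fsq fsq] norm_abs_l2[OF dsq]
      by (rule nn_integral_eq_integral[symmetric]) (use dsq in \<open>auto simp: sq_integrable_def\<close>)
    also have "\<dots> \<le> ennreal ((1/4)^n)" by (rule Ffn)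
    also have "(1/4::real)^n = ((1/2)^n)\<^sup>2"
      by (simp add: power_mult[symmetric] mult.commute[of n]) (simp add: power_mult power2_eq_square)
    finally have "(norm (abs_l2 F - X (r n)))\<^sup>2 \<le> ((1/2)^n)\<^sup>2" by simp
    then have "norm (abs_l2 F - X (r n)) \<le> (1/2)^n" by (rule power2_le_imp_le) simp
    then show ?thesis by (simp add: norm_minus_commute)
  qed
  then have "(\<lambda>n. X (r n) - abs_l2 F) \<longlonglongrightarrow> 0"
    by (intro Lim_null_comparison[OF always_eventually LIMSEQ_power_zero[of "1/2::real"]]) auto
  then have "(X \<circ> r) \<longlonglongrightarrow> abs_l2 F"
    by (simp add: LIM_zero_iff o_def)
  then have "X \<longlonglongrightarrow> abs_l2 F"
    using Cauchy_converges_subseq[OF assms sm] by simp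
  then show ?thesis by (rule convergentI)
qed

section \<open>Closure of a symmetric form and its resolvent\<close>

text \<open>The minimum is at \<open>t = B / C\<close>. If \<open>C = 0\<close>, letting \<open>t\<close> grow forces \<open>B = 0\<close>; the witness
  \<open>t = (A + 1) / (2 * B)\<close> gives the value \<open>-1\<close>.\<close>

lemma nonneg_quadratic_discriminant:
  fixes A B C :: real
  assumes "\<And>t. 0 \<le> A - 2 * t * B + t\<^sup>2 * C" and "0 \<le> C"
  shows "B\<^sup>2 \<le> A * C"
proof (cases "C = 0")
  case True
  have "B = 0"
  proof (rule ccontr)
    assume "B \<noteq> 0"
    then show False using assms(1)[of "(A + 1) / (2 * B)"] True by simp
  qed
  then show ?thesis using True by simp
next
  case False
  then have C: "C > 0" using assms(2) by simp
  have "0 \<le> A - 2 * (B / C) * B + (B / C)\<^sup>2 * C" by (rule assms(1))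
  also have "\<dots> = A - B\<^sup>2 / C" using C by (simp add: power2_eq_square field_simps)
  finally show ?thesis using C by (simp add: field_simps)
qed

text \<open>A non-negative sesquilinear form on a complex subspace that is the form of a symmetric operator:
  by \<open>represented\<close>, with \<open>h\<close> the image of \<open>v\<close>, the form is continuous in its first
  argument for the norm of the ambient space. This is what makes it closable.\<close>

locale symmetric_form =
  fixes D :: "'n::finite l2 set" and q :: "'n l2 \<Rightarrow> 'n l2 \<Rightarrow> complex"
  assumes zero_mem: "0 \<in> D"
    and add_mem: "u \<in> D \<Longrightarrow> v \<in> D \<Longrightarrow> u + v \<in> D"
    and scaleC_mem: "u \<in> D \<Longrightarrow> scaleC_l2 c u \<in> D"
    and add_left: "u \<in> D \<Longrightarrow> v \<in> D \<Longrightarrow> w \<in> D \<Longrightarrow> q (u + v) w = q u w + q v w"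
    and scaleC_left: "u \<in> D \<Longrightarrow> v \<in> D \<Longrightarrow> q (scaleC_l2 c u) v = c * q u v"
    and hermitian: "u \<in> D \<Longrightarrow> v \<in> D \<Longrightarrow> q v u = cnj (q u v)"
    and nonneg: "u \<in> D \<Longrightarrow> 0 \<le> Re (q u u)"
    and represented: "v \<in> D \<Longrightarrow> \<exists>h. \<forall>u\<in>D. q u v = cinner_l2 u h"
begin

subsection \<open>Algebra of the form on its core\<close>

lemma diff_eq_scaleC: "u - v = u + scaleC_l2 (-1) (v :: 'n l2)"
  using scaleC_l2_of_real[of "-1" v] by simp

lemma diff_mem: "u \<in> D \<Longrightarrow> v \<in> D \<Longrightarrow> u - v \<in> D"
  unfolding diff_eq_scaleC by (intro add_mem scaleC_mem)

lemma scaleR_mem: "u \<in> D \<Longrightarrow> r *\<^sub>R u \<in> D"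
  using scaleC_mem[of u "of_real r"] by (simp add: scaleC_l2_of_real)

lemma diff_left: "u \<in> D \<Longrightarrow> v \<in> D \<Longrightarrow> w \<in> D \<Longrightarrow> q (u - v) w = q u w - q v w"
  unfolding diff_eq_scaleC by (simp add: add_left scaleC_mem scaleC_left)

lemma scaleR_left: "u \<in> D \<Longrightarrow> v \<in> D \<Longrightarrow> q (r *\<^sub>R u) v = of_real r * q u v"
  using scaleC_left[of u v "of_real r"] by (simp add: scaleC_l2_of_real)

lemma add_right: "u \<in> D \<Longrightarrow> v \<in> D \<Longrightarrow> w \<in> D \<Longrightarrow> q w (u + v) = q w u + q w v"
  by (simp add: hermitian[of _ w] add_mem add_left)

lemma diff_right: "u \<in> D \<Longrightarrow> v \<in> D \<Longrightarrow> w \<in> D \<Longrightarrow> q w (u - v) = q w u - q w v"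
  by (simp add: hermitian[of _ w] diff_mem diff_left)

lemma scaleC_right: "u \<in> D \<Longrightarrow> v \<in> D \<Longrightarrow> q u (scaleC_l2 c v) = cnj c * q u v"
  by (simp add: hermitian[of _ u] scaleC_mem scaleC_left)

lemma scaleR_right: "u \<in> D \<Longrightarrow> v \<in> D \<Longrightarrow> q u (r *\<^sub>R v) = of_real r * q u v"
  using scaleC_right[of u v "of_real r"] by (simp add: scaleC_l2_of_real)

abbreviation Q :: "'n l2 \<Rightarrow> real" where "Q u \<equiv> Re (q u u)"

lemma self_eq_Re: "u \<in> D \<Longrightarrow> q u u = of_real (Q u)"
  using hermitian[of u u] by (simp add: complex_eq_iff)

lemma Re_commute: "u \<in> D \<Longrightarrow> v \<in> D \<Longrightarrow> Re (q v u) = Re (q u v)"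
  by (simp add: hermitian[of u v])

lemma Q_add: "u \<in> D \<Longrightarrow> v \<in> D \<Longrightarrow> Q (u + v) = Q u + 2 * Re (q u v) + Q v"
  by (simp add: add_left add_right add_mem Re_commute[of u v])

lemma Q_diff: "u \<in> D \<Longrightarrow> v \<in> D \<Longrightarrow> Q (u - v) = Q u - 2 * Re (q u v) + Q v"
  by (simp add: diff_left diff_right diff_mem Re_commute[of u v])

lemma Q_scaleR: "u \<in> D \<Longrightarrow> Q (r *\<^sub>R u) = r\<^sup>2 * Q u"
  by (simp add: scaleR_left scaleR_right scaleR_mem power2_eq_square)

lemma Q_scaleC: "u \<in> D \<Longrightarrow> Q (scaleC_l2 c u) = (cmod c)\<^sup>2 * Q u"
proof -
  assume u: "u \<in> D"
  have "q (scaleC_l2 c u) (scaleC_l2 c u) = (c * cnj c) * q u u"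
    using u by (simp add: scaleC_left scaleC_right scaleC_mem mult.assoc)
  also have "\<dots> = (cmod c)\<^sup>2 *\<^sub>R q u u"
    by (simp only: complex_norm_square[symmetric] scaleR_conv_of_real)
  finally show ?thesis by simp
qed

lemma Q_add_le: "u \<in> D \<Longrightarrow> v \<in> D \<Longrightarrow> Q (u + v) \<le> 2 * Q u + 2 * Q v"
  using Q_add[of u v] Q_diff[of u v] nonneg[OF diff_mem[of u v]] by simp

lemma Cauchy_Schwarz:
  assumes u: "u \<in> D" and v: "v \<in> D"
  shows "cmod (q u v) \<le> sqrt (Q u) * sqrt (Q v)"
proof -
  \<comment> \<open>a phase that makes \<open>q u w\<close> real and non-negative\<close>
  define w where "w = scaleC_l2 (sgn (q u v)) v"
  have w: "w \<in> D" by (simp add: w_def scaleC_mem v)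
  have uw: "q u w = of_real (cmod (q u v))"
  proof -
    have "cnj z * z = of_real (cmod z) * of_real (cmod z)" for z :: complex
      by (metis complex_norm_square mult.commute power2_eq_square of_real_mult)
    then show ?thesis
      by (cases "q u v = 0")
        (simp_all add: w_def scaleC_right u v sgn_div_norm scaleR_conv_of_real field_simps)
  qed
  have "0 \<le> Q u - 2 * t * cmod (q u v) + t\<^sup>2 * Q w" for t
    using nonneg[OF diff_mem[OF u scaleR_mem[OF w, of t]]]
    by (simp add: Q_diff[OF u scaleR_mem[OF w]] Q_scaleR[OF w] scaleR_right[OF u w] uw)
  then have "(cmod (q u v))\<^sup>2 \<le> Q u * Q w"
    by (rule nonneg_quadratic_discriminant) (rule nonneg[OF w])
  also have "Q w \<le> Q v"
    using nonneg[OF v] by (simp add: w_def Q_scaleC v norm_sgn)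
  then have "Q u * Q w \<le> Q u * Q v" by (rule mult_left_mono) (rule nonneg[OF u])
  finally have "sqrt ((cmod (q u v))\<^sup>2) \<le> sqrt (Q u * Q v)" by (rule real_sqrt_le_mono)
  then show ?thesis by (simp add: real_sqrt_mult)
qed

lemma null_bounded_tendsto_0:
  assumes "\<And>n. x n \<in> D" "\<And>n. y n \<in> D" "(\<lambda>n. Q (x n)) \<longlonglongrightarrow> 0"
    and "\<forall>\<^sub>F n in sequentially. Q (y n) \<le> B"
  shows "(\<lambda>n. q (x n) (y n)) \<longlonglongrightarrow> 0"
proof (rule Lim_null_comparison)
  show "\<forall>\<^sub>F n in sequentially. norm (q (x n) (y n)) \<le> sqrt (Q (x n)) * sqrt B"
    using assms(4)
  proof eventually_elim
    case (elim n)
    have "norm (q (x n) (y n)) \<le> sqrt (Q (x n)) * sqrt (Q (y n))"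
      by (rule Cauchy_Schwarz) (use assms in auto)
    also have "\<dots> \<le> sqrt (Q (x n)) * sqrt B"
      using elim by (intro mult_left_mono real_sqrt_le_mono) (auto simp: nonneg assms)
    finally show ?case .
  qed
  have "(\<lambda>n. sqrt (Q (x n)) * sqrt B) \<longlonglongrightarrow> sqrt 0 * sqrt B"
    by (intro tendsto_intros assms)
  then show "(\<lambda>n. sqrt (Q (x n)) * sqrt B) \<longlonglongrightarrow> 0" by simp
qed

subsection \<open>Approximating sequences and closability\<close>

lemma form_approx_iff:
  "form_approx D q \<phi> u \<longleftrightarrow> (\<forall>n. \<phi> n \<in> D) \<and> \<phi> \<longlonglongrightarrow> u \<and>
     (\<forall>e>0. \<exists>M. \<forall>m\<ge>M. \<forall>n\<ge>M. Q (\<phi> m - \<phi> n) < e)"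
proof (cases "\<forall>n. \<phi> n \<in> D")
  case True
  then have "cmod (q (\<phi> m - \<phi> n) (\<phi> m - \<phi> n)) = Q (\<phi> m - \<phi> n)" for m n
    using self_eq_Re[of "\<phi> m - \<phi> n"] nonneg[of "\<phi> m - \<phi> n"] diff_mem
    by (metis norm_of_real abs_of_nonneg)
  then show ?thesis by (simp add: form_approx_def)
qed (auto simp: form_approx_def)

lemma form_approx_add:
  assumes "form_approx D q \<phi> u" "form_approx D q \<psi> v"
  shows "form_approx D q (\<lambda>n. \<phi> n + \<psi> n) (u + v)"
  unfolding form_approx_iff
proof (intro conjI allI impI)
  show "\<phi> n + \<psi> n \<in> D" for n using assms by (simp add: form_approx_iff add_mem)
  show "(\<lambda>n. \<phi> n + \<psi> n) \<longlonglongrightarrow> u + v"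
    using assms by (auto simp: form_approx_iff intro: tendsto_add)
  fix e :: real assume "e > 0"
  then have e: "e / 4 > 0" by simp
  obtain M1 where M1: "\<And>m n. m \<ge> M1 \<Longrightarrow> n \<ge> M1 \<Longrightarrow> Q (\<phi> m - \<phi> n) < e / 4"
    using assms(1) e unfolding form_approx_iff by meson
  obtain M2 where M2: "\<And>m n. m \<ge> M2 \<Longrightarrow> n \<ge> M2 \<Longrightarrow> Q (\<psi> m - \<psi> n) < e / 4"
    using assms(2) e unfolding form_approx_iff by meson
  have "Q (\<phi> m + \<psi> m - (\<phi> n + \<psi> n)) < e" if "m \<ge> max M1 M2" "n \<ge> max M1 M2" for m n
  proof -
    have "Q ((\<phi> m - \<phi> n) + (\<psi> m - \<psi> n)) \<le> 2 * Q (\<phi> m - \<phi> n) + 2 * Q (\<psi> m - \<psi> n)"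
      by (rule Q_add_le) (use assms in \<open>auto simp: form_approx_iff diff_mem\<close>)
    also have "\<dots> < e" using M1[of m n] M2[of m n] that by simp
    finally show ?thesis by (simp add: algebra_simps)
  qed
  then show "\<exists>M. \<forall>m\<ge>M. \<forall>n\<ge>M. Q (\<phi> m + \<psi> m - (\<phi> n + \<psi> n)) < e" by blast
qed

lemma form_approx_scaleC:
  assumes "form_approx D q \<phi> u"
  shows "form_approx D q (\<lambda>n. scaleC_l2 c (\<phi> n)) (scaleC_l2 c u)"
  unfolding form_approx_iff
proof (intro conjI allI impI)
  show "scaleC_l2 c (\<phi> n) \<in> D" for n using assms by (simp add: form_approx_iff scaleC_mem)
  show "(\<lambda>n. scaleC_l2 c (\<phi> n)) \<longlonglongrightarrow> scaleC_l2 c u"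
    using assms by (auto simp: form_approx_iff
        intro: bounded_linear.tendsto[OF bounded_linear_scaleC_l2])
  fix e :: real assume e: "e > 0"
  have p: "(cmod c)\<^sup>2 + 1 > 0" by (simp add: add_nonneg_pos)
  then have "e / ((cmod c)\<^sup>2 + 1) > 0" using e by simp
  then obtain M where M: "\<And>m n. m \<ge> M \<Longrightarrow> n \<ge> M \<Longrightarrow> Q (\<phi> m - \<phi> n) < e / ((cmod c)\<^sup>2 + 1)"
    using assms unfolding form_approx_iff by meson
  have "Q (scaleC_l2 c (\<phi> m) - scaleC_l2 c (\<phi> n)) < e" if "m \<ge> M" "n \<ge> M" for m n
  proof -
    have d: "\<phi> m - \<phi> n \<in> D" using assms by (simp add: form_approx_iff diff_mem)
    have "Q (scaleC_l2 c (\<phi> m) - scaleC_l2 c (\<phi> n)) = (cmod c)\<^sup>2 * Q (\<phi> m - \<phi> n)"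
      using Q_scaleC[OF d, of c]
      by (simp add: linear_diff[OF bounded_linear.linear[OF bounded_linear_scaleC_l2]])
    also have "\<dots> \<le> ((cmod c)\<^sup>2 + 1) * Q (\<phi> m - \<phi> n)"
      using nonneg[OF d] by (intro mult_right_mono) auto
    also have "\<dots> < e" using M[OF that] p by (simp add: field_simps)
    finally show ?thesis .
  qed
  then show "\<exists>M. \<forall>m\<ge>M. \<forall>n\<ge>M. Q (scaleC_l2 c (\<phi> m) - scaleC_l2 c (\<phi> n)) < e" by blast
qed

lemma form_approx_diff:
  assumes "form_approx D q \<phi> u" "form_approx D q \<psi> v"
  shows "form_approx D q (\<lambda>n. \<phi> n - \<psi> n) (u - v)"
  unfolding diff_eq_scaleC by (intro form_approx_add form_approx_scaleC assms)

text \<open>From some index on, a form-Cauchy sequence stays within distance one of a fixed member \<open>\<phi> M\<close>.\<close>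

lemma form_approx_bounded:
  assumes "form_approx D q \<phi> u"
  obtains B where "B \<ge> 0" "\<forall>\<^sub>F n in sequentially. Q (\<phi> n) \<le> B"
proof -
  have mem: "\<phi> n \<in> D" for n using assms by (simp add: form_approx_iff)
  obtain M where M: "\<And>m n. m \<ge> M \<Longrightarrow> n \<ge> M \<Longrightarrow> Q (\<phi> m - \<phi> n) < 1"
    using assms unfolding form_approx_iff by (meson zero_less_one)
  have "Q (\<phi> n) \<le> 2 + 2 * Q (\<phi> M)" if "n \<ge> M" for n
    using Q_add_le[OF diff_mem[OF mem[of n] mem[of M]] mem[of M]] M[OF that order_refl] by simp
  then have "\<forall>\<^sub>F n in sequentially. Q (\<phi> n) \<le> 2 + 2 * Q (\<phi> M)"
    by (auto simp: eventually_sequentially)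
  from that[OF _ this] show thesis using nonneg[OF mem[of M]] by simp
qed

text \<open>Closability: split \<open>q (\<phi> n) (\<phi> n) = q (\<phi> n) (\<phi> n - \<phi> M) + q (\<phi> n) (\<phi> M)\<close>. The first term is
  small for large \<open>M\<close> by the Cauchy property; for fixed \<open>M\<close> the second is an inner product of
  \<open>\<phi> n\<close> with a fixed vector of the Hilbert space, and \<open>\<phi> n\<close> tends to zero there.\<close>

lemma form_approx_zero:
  assumes "form_approx D q \<phi> 0"
  shows "(\<lambda>n. Q (\<phi> n)) \<longlonglongrightarrow> 0"
proof (rule LIMSEQ_I)
  fix e :: real assume e: "e > 0"
  have mem: "\<phi> n \<in> D" for n using assms by (simp add: form_approx_iff)
  have lim: "\<phi> \<longlonglongrightarrow> 0" using assms by (simp add: form_approx_iff)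
  obtain B where B: "B \<ge> 0" "\<forall>\<^sub>F n in sequentially. Q (\<phi> n) \<le> B"
    using form_approx_bounded[OF assms] .
  define K where "K = sqrt B + 1"
  have K: "K > 0" using B(1) by (simp add: K_def add_nonneg_pos)
  define d where "d = e / (2 * K)"
  have d: "d > 0" using e K by (simp add: d_def)
  then have "d\<^sup>2 > 0" by simp
  then obtain M where M: "\<And>m n. m \<ge> M \<Longrightarrow> n \<ge> M \<Longrightarrow> Q (\<phi> m - \<phi> n) < d\<^sup>2"
    using assms unfolding form_approx_iff by meson
  obtain h where h: "\<And>u. u \<in> D \<Longrightarrow> q u (\<phi> M) = cinner_l2 u h"
    using represented[OF mem[of M]] by blast
  have "(\<lambda>n. cinner_l2 (\<phi> n) h) \<longlonglongrightarrow> cinner_l2 0 h"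
    by (intro cinner_l2.tendsto lim tendsto_const)
  then have "(\<lambda>n. cmod (q (\<phi> n) (\<phi> M))) \<longlonglongrightarrow> 0"
    by (simp add: h[OF mem] cinner_l2.zero_left tendsto_norm_zero)
  then have "\<forall>\<^sub>F n in sequentially. cmod (q (\<phi> n) (\<phi> M)) < e / 2"
    by (rule order_tendstoD) (use e in simp)
  then have "\<forall>\<^sub>F n in sequentially. Q (\<phi> n) < e"
    using B(2) eventually_ge_at_top[of M]
  proof eventually_elim
    case (elim n)
    have "Q (\<phi> n) = Re (q (\<phi> n) (\<phi> n - \<phi> M)) + Re (q (\<phi> n) (\<phi> M))"
      by (simp add: diff_right mem)
    also have "\<dots> \<le> cmod (q (\<phi> n) (\<phi> n - \<phi> M)) + cmod (q (\<phi> n) (\<phi> M))"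
      by (intro add_mono complex_Re_le_cmod)
    also have "cmod (q (\<phi> n) (\<phi> n - \<phi> M)) \<le> sqrt (Q (\<phi> n)) * sqrt (Q (\<phi> n - \<phi> M))"
      by (intro Cauchy_Schwarz diff_mem mem)
    also have "\<dots> \<le> sqrt B * sqrt (d\<^sup>2)"
      using elim M[of n M] nonneg[OF mem[of n]] nonneg[OF diff_mem[OF mem[of n] mem[of M]]]
      by (intro mult_mono real_sqrt_le_mono) (auto simp: B(1))
    also have "\<dots> \<le> K * d" using d by (simp add: K_def)
    also have "\<dots> = e / 2" using K by (simp add: d_def)
    finally show ?case using elim(1) by simp
  qed
  then obtain N where "\<forall>n\<ge>N. Q (\<phi> n) < e" by (auto simp: eventually_sequentially)
  then show "\<exists>N. \<forall>n\<ge>N. norm (Q (\<phi> n) - 0) < e"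
    using nonneg[OF mem] by (auto intro!: exI[of _ N])
qed

lemma form_approx_tendsto_diff:
  assumes "form_approx D q \<phi> u" "form_approx D q \<phi>' u" "form_approx D q \<psi> v" "form_approx D q \<psi>' v"
  shows "(\<lambda>n. q (\<phi> n) (\<psi> n) - q (\<phi>' n) (\<psi>' n)) \<longlonglongrightarrow> 0"
proof -
  have mem: "\<phi> n \<in> D" "\<phi>' n \<in> D" "\<psi> n \<in> D" "\<psi>' n \<in> D" for n
    using assms by (auto simp: form_approx_iff)
  have n1: "(\<lambda>n. Q (\<phi> n - \<phi>' n)) \<longlonglongrightarrow> 0" and n2: "(\<lambda>n. Q (\<psi> n - \<psi>' n)) \<longlonglongrightarrow> 0"
    using form_approx_zero form_approx_diff[OF assms(1,2)] form_approx_diff[OF assms(3,4)] by auto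
  obtain B1 where B1: "\<forall>\<^sub>F n in sequentially. Q (\<psi> n) \<le> B1"
    using form_approx_bounded[OF assms(3)] by blast
  obtain B2 where B2: "\<forall>\<^sub>F n in sequentially. Q (\<phi>' n) \<le> B2"
    using form_approx_bounded[OF assms(2)] by blast
  have "(\<lambda>n. q (\<phi> n - \<phi>' n) (\<psi> n)) \<longlonglongrightarrow> 0"
    by (rule null_bounded_tendsto_0[OF _ _ n1 B1]) (auto intro: diff_mem mem)
  moreover have "(\<lambda>n. q (\<psi> n - \<psi>' n) (\<phi>' n)) \<longlonglongrightarrow> 0"
    by (rule null_bounded_tendsto_0[OF _ _ n2 B2]) (auto intro: diff_mem mem)
  then have "(\<lambda>n. cnj (q (\<psi> n - \<psi>' n) (\<phi>' n))) \<longlonglongrightarrow> cnj 0" by (rule tendsto_cnj)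
  ultimately have "(\<lambda>n. q (\<phi> n - \<phi>' n) (\<psi> n) + cnj (q (\<psi> n - \<psi>' n) (\<phi>' n))) \<longlonglongrightarrow> 0 + cnj 0"
    by (rule tendsto_add)
  moreover have "q (\<phi> n - \<phi>' n) (\<psi> n) + cnj (q (\<psi> n - \<psi>' n) (\<phi>' n))
      = q (\<phi> n) (\<psi> n) - q (\<phi>' n) (\<psi>' n)" for n
    by (simp add: diff_left mem hermitian[symmetric] diff_mem diff_right)
  ultimately show ?thesis by simp
qed

lemma form_approx_convergent:
  assumes "form_approx D q \<phi> u" "form_approx D q \<psi> v"
  shows "convergent (\<lambda>n. q (\<phi> n) (\<psi> n))"
proof (rule Cauchy_convergent, rule CauchyI)
  fix e :: real assume e: "e > 0"
  have mem: "\<phi> n \<in> D" "\<psi> n \<in> D" for n using assms by (auto simp: form_approx_iff)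
  obtain B1 where B1: "B1 \<ge> 0" "\<forall>\<^sub>F n in sequentially. Q (\<phi> n) \<le> B1"
    using form_approx_bounded[OF assms(1)] .
  obtain B2 where B2: "B2 \<ge> 0" "\<forall>\<^sub>F n in sequentially. Q (\<psi> n) \<le> B2"
    using form_approx_bounded[OF assms(2)] .
  define K where "K = sqrt B1 + sqrt B2 + 1"
  have K: "K > 0" using B1 B2 by (simp add: K_def add_nonneg_pos)
  define d where "d = e / K"
  have d: "d > 0" using e K by (simp add: d_def)
  then have d2: "d\<^sup>2 > 0" by simp
  obtain M1 where M1: "\<And>m n. m \<ge> M1 \<Longrightarrow> n \<ge> M1 \<Longrightarrow> Q (\<phi> m - \<phi> n) < d\<^sup>2"
    using assms(1) d2 unfolding form_approx_iff by meson
  obtain M2 where M2: "\<And>m n. m \<ge> M2 \<Longrightarrow> n \<ge> M2 \<Longrightarrow> Q (\<psi> m - \<psi> n) < d\<^sup>2"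
    using assms(2) d2 unfolding form_approx_iff by meson
  obtain M3 where M3: "\<And>n. n \<ge> M3 \<Longrightarrow> Q (\<phi> n) \<le> B1 \<and> Q (\<psi> n) \<le> B2"
    using eventually_conj[OF B1(2) B2(2)] by (auto simp: eventually_sequentially)
  define M where "M = max M1 (max M2 M3)"
  have "cmod (q (\<phi> m) (\<psi> m) - q (\<phi> n) (\<psi> n)) < e" if "m \<ge> M" "n \<ge> M" for m n
  proof -
    have "q (\<phi> m) (\<psi> m) - q (\<phi> n) (\<psi> n) = q (\<phi> m - \<phi> n) (\<psi> m) + q (\<phi> n) (\<psi> m - \<psi> n)"
      by (simp add: diff_left diff_right mem)
    then have "cmod (q (\<phi> m) (\<psi> m) - q (\<phi> n) (\<psi> n))
        \<le> cmod (q (\<phi> m - \<phi> n) (\<psi> m)) + cmod (q (\<phi> n) (\<psi> m - \<psi> n))"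
      by (simp add: norm_triangle_ineq)
    also have "\<dots> \<le> sqrt (Q (\<phi> m - \<phi> n)) * sqrt (Q (\<psi> m)) + sqrt (Q (\<phi> n)) * sqrt (Q (\<psi> m - \<psi> n))"
      by (intro add_mono Cauchy_Schwarz diff_mem mem)
    also have "\<dots> \<le> sqrt (d\<^sup>2) * sqrt B2 + sqrt B1 * sqrt (d\<^sup>2)"
      using that M1[of m n] M2[of m n] M3[of m] M3[of n]
      by (intro add_mono mult_mono real_sqrt_le_mono)
        (auto simp: M_def B1(1) B2(1) nonneg diff_mem mem)
    also have "\<dots> = d * (sqrt B1 + sqrt B2)" using d by (simp add: algebra_simps)
    also have "\<dots> < d * K" using d by (simp add: K_def)
    finally show ?thesis using K by (simp add: d_def)
  qed
  then show "\<exists>M. \<forall>m\<ge>M. \<forall>n\<ge>M. norm (q (\<phi> m) (\<psi> m) - q (\<phi> n) (\<psi> n)) < e" by blast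
qed

text \<open>The description selecting the value of the closed form is met by exactly one number: by
  closability all approximating sequences give the same limit.\<close>

lemma closure_form_tendsto:
  assumes "form_approx D q \<phi> u" "form_approx D q \<psi> v"
  shows "(\<lambda>n. q (\<phi> n) (\<psi> n)) \<longlonglongrightarrow> closure_form D q u v"
proof -
  obtain c where c: "(\<lambda>n. q (\<phi> n) (\<psi> n)) \<longlonglongrightarrow> c"
    using form_approx_convergent[OF assms] by (auto simp: convergent_def)
  have "closure_form D q u v = c"
    unfolding closure_form_def
  proof (rule the_equality)
    show "\<forall>\<phi>' \<psi>'. form_approx D q \<phi>' u \<longrightarrow> form_approx D q \<psi>' v \<longrightarrow> (\<lambda>n. q (\<phi>' n) (\<psi>' n)) \<longlonglongrightarrow> c"
    proof (intro allI impI)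
      fix \<phi>' \<psi>' assume a: "form_approx D q \<phi>' u" "form_approx D q \<psi>' v"
      show "(\<lambda>n. q (\<phi>' n) (\<psi>' n)) \<longlonglongrightarrow> c"
        using tendsto_diff[OF c form_approx_tendsto_diff[OF assms(1) a(1) assms(2) a(2)]] by simp
    qed
    show "c' = c" if "\<forall>\<phi>' \<psi>'. form_approx D q \<phi>' u \<longrightarrow> form_approx D q \<psi>' v \<longrightarrow>
        (\<lambda>n. q (\<phi>' n) (\<psi>' n)) \<longlonglongrightarrow> c'" for c'
      using that assms c LIMSEQ_unique by blast
  qed
  then show ?thesis using c by simp
qed

subsection \<open>The closed form\<close>

abbreviation Dc :: "'n l2 set" where "Dc \<equiv> closure_dom D q"
abbreviation qc :: "'n l2 \<Rightarrow> 'n l2 \<Rightarrow> complex" where "qc \<equiv> closure_form D q"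

lemma closure_domE:
  assumes "u \<in> Dc"
  obtains \<phi> where "form_approx D q \<phi> u"
  using assms by (auto simp: closure_dom_def)

lemma closure_domI: "form_approx D q \<phi> u \<Longrightarrow> u \<in> Dc"
  by (auto simp: closure_dom_def)

lemma closure_dom_add: "u \<in> Dc \<Longrightarrow> v \<in> Dc \<Longrightarrow> u + v \<in> Dc"
  by (meson closure_domE closure_domI form_approx_add)

lemma closure_dom_scaleC: "u \<in> Dc \<Longrightarrow> scaleC_l2 c u \<in> Dc"
  by (meson closure_domE closure_domI form_approx_scaleC)

lemma closure_form_add_left:
  assumes "u \<in> Dc" "v \<in> Dc" "w \<in> Dc"
  shows "qc (u + v) w = qc u w + qc v w"
proof -
  obtain \<phi> \<psi> \<eta> where a: "form_approx D q \<phi> u" "form_approx D q \<psi> v" "form_approx D q \<eta> w"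
    using assms closure_domE by metis
  have "(\<lambda>n. q (\<phi> n + \<psi> n) (\<eta> n)) \<longlonglongrightarrow> qc (u + v) w"
    by (rule closure_form_tendsto[OF form_approx_add[OF a(1,2)] a(3)])
  moreover have "(\<lambda>n. q (\<phi> n) (\<eta> n) + q (\<psi> n) (\<eta> n)) \<longlonglongrightarrow> qc u w + qc v w"
    by (intro tendsto_add closure_form_tendsto a)
  moreover have "q (\<phi> n + \<psi> n) (\<eta> n) = q (\<phi> n) (\<eta> n) + q (\<psi> n) (\<eta> n)" for n
    using a by (simp add: form_approx_iff add_left)
  ultimately show ?thesis using LIMSEQ_unique by simp
qed

lemma closure_form_scaleC_left:
  assumes "u \<in> Dc" "v \<in> Dc"
  shows "qc (scaleC_l2 c u) v = c * qc u v"
proof -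
  obtain \<phi> \<psi> where a: "form_approx D q \<phi> u" "form_approx D q \<psi> v"
    using assms closure_domE by metis
  have "(\<lambda>n. q (scaleC_l2 c (\<phi> n)) (\<psi> n)) \<longlonglongrightarrow> qc (scaleC_l2 c u) v"
    by (rule closure_form_tendsto[OF form_approx_scaleC[OF a(1)] a(2)])
  moreover have "(\<lambda>n. c * q (\<phi> n) (\<psi> n)) \<longlonglongrightarrow> c * qc u v"
    by (intro tendsto_mult tendsto_const closure_form_tendsto a)
  moreover have "q (scaleC_l2 c (\<phi> n)) (\<psi> n) = c * q (\<phi> n) (\<psi> n)" for n
    using a by (simp add: form_approx_iff scaleC_left)
  ultimately show ?thesis using LIMSEQ_unique by simp
qed

lemma closure_form_hermitian:
  assumes "u \<in> Dc" "v \<in> Dc"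
  shows "qc v u = cnj (qc u v)"
proof -
  obtain \<phi> \<psi> where a: "form_approx D q \<phi> u" "form_approx D q \<psi> v"
    using assms closure_domE by metis
  have "(\<lambda>n. q (\<psi> n) (\<phi> n)) \<longlonglongrightarrow> qc v u"
    by (rule closure_form_tendsto[OF a(2,1)])
  moreover have "(\<lambda>n. cnj (q (\<phi> n) (\<psi> n))) \<longlonglongrightarrow> cnj (qc u v)"
    by (intro tendsto_cnj closure_form_tendsto a)
  moreover have "q (\<psi> n) (\<phi> n) = cnj (q (\<phi> n) (\<psi> n))" for n
    using a by (auto simp: form_approx_iff intro: hermitian)
  ultimately show ?thesis using LIMSEQ_unique by simp
qed

lemma closure_form_nonneg:
  assumes "u \<in> Dc"
  shows "0 \<le> Re (qc u u)"
proof -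
  obtain \<phi> where a: "form_approx D q \<phi> u" using assms closure_domE by metis
  have "(\<lambda>n. Q (\<phi> n)) \<longlonglongrightarrow> Re (qc u u)"
    by (intro tendsto_Re closure_form_tendsto a)
  then show ?thesis
    by (rule LIMSEQ_le_const) (use a in \<open>auto simp: form_approx_iff nonneg\<close>)
qed

subsection \<open>Solving the resolvent equation\<close>

text \<open>The weak form of \<open>(H + \<alpha>) u = f\<close>, where \<open>H\<close> is the operator associated with the closed form.\<close>

definition resolvent_eq :: "real \<Rightarrow> 'n l2 \<Rightarrow> 'n l2 \<Rightarrow> bool" where
  "resolvent_eq \<alpha> f u \<longleftrightarrow>
     u \<in> Dc \<and> (\<forall>v\<in>Dc. qc u v + of_real \<alpha> * cinner_l2 u v = cinner_l2 f v)"

lemma plus_scalar_form_operator_iff: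
  "(u, f) \<in> plus_scalar (form_operator Dc qc) \<alpha> \<longleftrightarrow> resolvent_eq \<alpha> f u"
proof -
  have "(u, f) \<in> plus_scalar (form_operator Dc qc) \<alpha> \<longleftrightarrow> (u, f - \<alpha> *\<^sub>R u) \<in> form_operator Dc qc"
    by (auto simp: plus_scalar_def) (metis add.commute diff_add_cancel)
  then show ?thesis
    by (auto simp: form_operator_def resolvent_eq_def cinner_l2.diff_left cinner_l2.scaleR_left
        scaleR_conv_of_real algebra_simps)
qed

lemma resolvent_energy:
  assumes "resolvent_eq \<alpha> f u"
  shows "Re (qc u u) + \<alpha> * (norm u)\<^sup>2 = Re (cinner_l2 f u)"
proof -
  have "qc u u + of_real \<alpha> * cinner_l2 u u = cinner_l2 f u"
    using assms by (auto simp: resolvent_eq_def)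
  then have "Re (qc u u + of_real \<alpha> * cinner_l2 u u) = Re (cinner_l2 f u)" by simp
  then show ?thesis by (simp add: Re_cinner_l2_self)
qed

text \<open>Both bounds come from testing the equation with its own solution; the first one contains
  uniqueness, as the case \<open>f = 0\<close>.\<close>

lemma resolvent_bounds:
  assumes "resolvent_eq \<alpha> f u" "\<alpha> > 0"
  shows "norm u \<le> norm f / \<alpha>" and "Re (qc u u) \<le> (norm f)\<^sup>2 / \<alpha>"
proof -
  have u: "u \<in> Dc" using assms by (simp add: resolvent_eq_def)
  have le: "Re (cinner_l2 f u) \<le> norm f * norm u"
    using complex_Re_le_cmod cmod_cinner_l2_le by (rule order_trans)
  have 1: "\<alpha> * (norm u * norm u) \<le> norm f * norm u"
    using resolvent_energy[OF assms(1)] closure_form_nonneg[OF u] le by (simp add: power2_eq_square)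
  show n: "norm u \<le> norm f / \<alpha>"
  proof (cases "norm u = 0")
    case False
    then have "norm u > 0" by simp
    then have "\<alpha> * norm u \<le> norm f" using 1 by (simp add: mult.assoc[symmetric])
    then show ?thesis using assms(2) by (simp add: field_simps)
  qed (use assms(2) in simp)
  have "Re (qc u u) \<le> norm f * norm u"
    using resolvent_energy[OF assms(1)] le assms(2)
    by (smt (verit) mult_nonneg_nonneg zero_le_power2)
  also have "\<dots> \<le> norm f * (norm f / \<alpha>)" by (intro mult_left_mono n) simp
  finally show "Re (qc u u) \<le> (norm f)\<^sup>2 / \<alpha>" by (simp add: power2_eq_square)
qed

lemma resolvent_eq_add:
  assumes "resolvent_eq \<alpha> f u" "resolvent_eq \<alpha> g v"
  shows "resolvent_eq \<alpha> (f + g) (u + v)"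
  unfolding resolvent_eq_def
proof (intro conjI ballI)
  have mem: "u \<in> Dc" "v \<in> Dc" using assms by (auto simp: resolvent_eq_def)
  then show "u + v \<in> Dc" by (rule closure_dom_add)
  fix w assume w: "w \<in> Dc"
  have "qc (u + v) w + of_real \<alpha> * cinner_l2 (u + v) w
      = (qc u w + of_real \<alpha> * cinner_l2 u w) + (qc v w + of_real \<alpha> * cinner_l2 v w)"
    using mem w by (simp add: closure_form_add_left cinner_l2_add_left distrib_left)
  also have "\<dots> = cinner_l2 f w + cinner_l2 g w"
    using assms w unfolding resolvent_eq_def by metis
  finally show "qc (u + v) w + of_real \<alpha> * cinner_l2 (u + v) w = cinner_l2 (f + g) w"
    by (simp only: cinner_l2_add_left)
qed

lemma resolvent_eq_scaleC:
  assumes "resolvent_eq \<alpha> f u"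
  shows "resolvent_eq \<alpha> (scaleC_l2 c f) (scaleC_l2 c u)"
  unfolding resolvent_eq_def
proof (intro conjI ballI)
  have mem: "u \<in> Dc" using assms by (simp add: resolvent_eq_def)
  then show "scaleC_l2 c u \<in> Dc" by (rule closure_dom_scaleC)
  fix w assume w: "w \<in> Dc"
  have "qc (scaleC_l2 c u) w + of_real \<alpha> * cinner_l2 (scaleC_l2 c u) w
      = c * (qc u w + of_real \<alpha> * cinner_l2 u w)"
    using mem w by (simp add: closure_form_scaleC_left cinner_l2_scaleC_left distrib_left)
  also have "\<dots> = c * cinner_l2 f w"
    using assms w unfolding resolvent_eq_def by metis
  finally show "qc (scaleC_l2 c u) w + of_real \<alpha> * cinner_l2 (scaleC_l2 c u) w
      = cinner_l2 (scaleC_l2 c f) w"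
    by (simp only: cinner_l2_scaleC_left)
qed

lemma resolvent_eq_unique:
  assumes "resolvent_eq \<alpha> f u" "resolvent_eq \<alpha> f v" "\<alpha> > 0"
  shows "u = v"
proof -
  have "resolvent_eq \<alpha> (f - f) (u - v)"
    unfolding diff_eq_scaleC by (intro resolvent_eq_add resolvent_eq_scaleC assms)
  from resolvent_bounds(1)[OF this assms(3)] show ?thesis by simp
qed

text \<open>Minimise \<open>J v = q v v + \<alpha> * \<parallel>v\<parallel>\<^sup>2 - 2 * Re \<langle>f, v\<rangle>\<close> over the core. By the parallelogram law a
  minimising sequence is Cauchy for the form and in norm, so its limit lies in the closed form
  domain. Moving the sequence by \<open>t * \<psi> n\<close> with \<open>t = \<plusminus> 1 / sqrt (n + 1)\<close> cannot lower \<open>J\<close> by more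
  than \<open>1 / (n + 1)\<close>, which forces the first variation to vanish in the limit, for every
  approximating sequence \<open>\<psi>\<close> at once.\<close>

lemma resolvent_eq_exists:
  assumes \<alpha>: "\<alpha> > 0"
  shows "\<exists>u. resolvent_eq \<alpha> f u"
proof -
  define E where "E v = Q v + \<alpha> * (norm v)\<^sup>2" for v
  define J where "J v = E v - 2 * inner f v" for v
  have bdd: "- ((norm f)\<^sup>2 / \<alpha>) \<le> J v" if "v \<in> D" for v
  proof -
    have "0 \<le> (\<alpha> * norm v - norm f)\<^sup>2 / \<alpha>" using \<alpha> by simp
    also have "\<dots> = \<alpha> * (norm v)\<^sup>2 - 2 * (norm f * norm v) + (norm f)\<^sup>2 / \<alpha>"
      using \<alpha> by (simp add: power2_eq_square field_simps)
    finally show ?thesis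
      using norm_cauchy_schwarz[of f v] nonneg[OF that] by (simp add: J_def E_def)
  qed
  define d where "d = (INF v\<in>D. J v)"
  have bb: "bdd_below (J ` D)" using bdd by (intro bdd_belowI2)
  have d_le: "d \<le> J v" if "v \<in> D" for v
    unfolding d_def by (rule cINF_lower[OF bb that])
  have "\<exists>v\<in>D. J v < d + inverse (real (Suc n))" for n
  proof -
    have "(INF v\<in>D. J v) < d + inverse (real (Suc n))" by (simp add: d_def)
    then show ?thesis using cINF_less_iff[OF _ bb] zero_mem by blast
  qed
  then obtain \<phi> where \<phi>D: "\<And>n. \<phi> n \<in> D" and \<phi>J: "\<And>n. J (\<phi> n) < d + inverse (real (Suc n))"
    by metis
  have par: "E (u - v) = 2 * J u + 2 * J v - 4 * J ((1/2) *\<^sub>R (u + v))" if "u \<in> D" "v \<in> D" for u v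
  proof -
    have h: "J ((1/2) *\<^sub>R (u + v)) = E (u + v) / 4 - inner f (u + v)"
      by (simp add: J_def E_def Q_scaleR[OF add_mem[OF that]] power_divide)
    have "E (u + v) + E (u - v) = 2 * E u + 2 * E v"
      unfolding E_def Q_add[OF that] Q_diff[OF that]
      by (simp add: power2_norm_eq_inner inner_simps algebra_simps)
    then show ?thesis unfolding h by (simp add: J_def inner_simps)
  qed
  have Esmall: "E (\<phi> m - \<phi> n) < e" if "e > 0" "m \<ge> M" "n \<ge> M" "4 * inverse (real (Suc M)) < e" for m n M e
  proof -
    define z where "z = (1/2) *\<^sub>R (\<phi> m + \<phi> n)"
    have "z \<in> D" unfolding z_def by (intro scaleR_mem add_mem \<phi>D)
    moreover have "E (\<phi> m - \<phi> n) = 2 * J (\<phi> m) + 2 * J (\<phi> n) - 4 * J z"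
      unfolding z_def by (rule par[OF \<phi>D \<phi>D])
    ultimately have "E (\<phi> m - \<phi> n) < 2 * inverse (real (Suc m)) + 2 * inverse (real (Suc n))"
      using \<phi>J[of m] \<phi>J[of n] d_le[of z] by (simp del: of_nat_Suc)
    also have "\<dots> \<le> 2 * inverse (real (Suc M)) + 2 * inverse (real (Suc M))"
      using that by (intro add_mono mult_left_mono le_imp_inverse_le) auto
    finally show ?thesis using that by simp
  qed
  have ECauchy: "\<exists>M. \<forall>m\<ge>M. \<forall>n\<ge>M. E (\<phi> m - \<phi> n) < e" if e: "e > 0" for e
  proof -
    obtain M where "inverse (real (Suc M)) < e / 4"
      using reals_Archimedean[of "e / 4"] e by auto
    then show ?thesis using Esmall[OF e, of M] by (intro exI[of _ M]) auto
  qed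
  have "Cauchy \<phi>"
  proof (rule CauchyI)
    fix e :: real assume e: "e > 0"
    then have "\<alpha> * e\<^sup>2 > 0" using \<alpha> by simp
    from ECauchy[OF this] obtain M where M: "\<forall>m\<ge>M. \<forall>n\<ge>M. E (\<phi> m - \<phi> n) < \<alpha> * e\<^sup>2" by blast
    have "norm (\<phi> m - \<phi> n) < e" if "m \<ge> M" "n \<ge> M" for m n
    proof -
      have "\<alpha> * (norm (\<phi> m - \<phi> n))\<^sup>2 < \<alpha> * e\<^sup>2"
        using M that nonneg[OF diff_mem[OF \<phi>D[of m] \<phi>D[of n]]] unfolding E_def by fastforce
      then have "(norm (\<phi> m - \<phi> n))\<^sup>2 < e\<^sup>2" using \<alpha> by simp
      then show ?thesis by (rule power_less_imp_less_base) (use e in simp)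
    qed
    then show "\<exists>M. \<forall>m\<ge>M. \<forall>n\<ge>M. norm (\<phi> m - \<phi> n) < e" by blast
  qed
  then obtain u where u: "\<phi> \<longlonglongrightarrow> u"
    using l2_Cauchy_convergent convergent_def by blast
  have ap: "form_approx D q \<phi> u"
    unfolding form_approx_iff
  proof (intro conjI allI impI)
    fix e :: real assume "e > 0"
    from ECauchy[OF this] obtain M where M: "\<forall>m\<ge>M. \<forall>n\<ge>M. E (\<phi> m - \<phi> n) < e" by blast
    have "Q v \<le> E v" for v using \<alpha> by (simp add: E_def)
    then show "\<exists>M. \<forall>m\<ge>M. \<forall>n\<ge>M. Q (\<phi> m - \<phi> n) < e"
      using M by (meson le_less_trans)
  qed (use \<phi>D u in auto)
  have re: "Re (qc u v + of_real \<alpha> * cinner_l2 u v - cinner_l2 f v) = 0" if v: "v \<in> Dc" for v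
  proof -
    obtain \<psi> where \<psi>: "form_approx D q \<psi> v" using v closure_domE by metis
    have \<psi>D: "\<psi> n \<in> D" for n using \<psi> by (simp add: form_approx_iff)
    have \<psi>lim: "\<psi> \<longlonglongrightarrow> v" using \<psi> by (simp add: form_approx_iff)
    define R where "R n = Re (q (\<phi> n) (\<psi> n) + of_real \<alpha> * cinner_l2 (\<phi> n) (\<psi> n) - cinner_l2 f (\<psi> n))" for n
    have R1: "R \<longlonglongrightarrow> Re (qc u v + of_real \<alpha> * cinner_l2 u v - cinner_l2 f v)"
      unfolding R_def
      by (intro tendsto_intros closure_form_tendsto ap \<psi> cinner_l2.tendsto u \<psi>lim)
    have norm_t: "(norm (\<phi> n + t *\<^sub>R \<psi> n))\<^sup>2
        = (norm (\<phi> n))\<^sup>2 + 2 * t * inner (\<phi> n) (\<psi> n) + t\<^sup>2 * (norm (\<psi> n))\<^sup>2" for n t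
      unfolding power2_norm_eq_inner
      by (simp add: inner_simps inner_commute[of "\<psi> n" "\<phi> n"] power2_eq_square algebra_simps)
    have Jt: "J (\<phi> n + t *\<^sub>R \<psi> n) = J (\<phi> n) + 2 * t * R n + t\<^sup>2 * E (\<psi> n)" for n t
      unfolding J_def E_def R_def Q_add[OF \<phi>D scaleR_mem[OF \<psi>D]] Q_scaleR[OF \<psi>D]
        scaleR_right[OF \<phi>D \<psi>D] norm_t
      by (simp add: inner_simps inner_l2_def[symmetric] algebra_simps)
    have Rt: "- (2 * t * R n) \<le> t\<^sup>2 * E (\<psi> n) + inverse (real (Suc n))" for n t
      using d_le[OF add_mem[OF \<phi>D scaleR_mem[OF \<psi>D, of t]], of n n] \<phi>J[of n] unfolding Jt by simp
    have Rle: "\<bar>R n\<bar> \<le> (E (\<psi> n) + 1) / (2 * sqrt (real (Suc n)))" for n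
    proof -
      define s where "s = sqrt (real (Suc n))"
      have s: "s > 0" "s * s = real (Suc n)" by (simp_all add: s_def)
      have "2 * (1 / s) * \<bar>R n\<bar> \<le> (1 / s)\<^sup>2 * E (\<psi> n) + inverse (s * s)"
        using Rt[where t="1 / s" and n=n] Rt[where t="- (1 / s)" and n=n]
        by (cases "R n \<ge> 0") (simp_all add: s(2)[symmetric] del: of_nat_Suc)
      then have "2 * s * \<bar>R n\<bar> \<le> E (\<psi> n) + 1"
        using s(1) by (simp add: field_simps power2_eq_square)
      then show ?thesis using s(1) unfolding s_def[symmetric] by (simp add: field_simps)
    qed
    obtain B where B: "\<forall>\<^sub>F n in sequentially. Q (\<psi> n) \<le> B"
      using form_approx_bounded[OF \<psi>] by blast
    have "\<forall>\<^sub>F n in sequentially. (norm (\<psi> n))\<^sup>2 < (norm v)\<^sup>2 + 1"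
      by (rule order_tendstoD[where y="(norm v)\<^sup>2"]) (auto intro!: tendsto_intros \<psi>lim)
    with B have "\<forall>\<^sub>F n in sequentially.
        norm (R n) \<le> (B + \<alpha> * ((norm v)\<^sup>2 + 1) + 1) / (2 * sqrt (real (Suc n)))"
    proof eventually_elim
      case (elim n)
      have "E (\<psi> n) \<le> B + \<alpha> * ((norm v)\<^sup>2 + 1)"
        unfolding E_def using elim \<alpha> by (intro add_mono mult_left_mono) auto
      then have "(E (\<psi> n) + 1) / (2 * sqrt (real (Suc n)))
          \<le> (B + \<alpha> * ((norm v)\<^sup>2 + 1) + 1) / (2 * sqrt (real (Suc n)))"
        by (intro divide_right_mono) auto
      then show ?case using Rle[of n] by simp
    qed
    moreover have "(\<lambda>n. (B + \<alpha> * ((norm v)\<^sup>2 + 1) + 1) / (2 * sqrt (real (Suc n)))) \<longlonglongrightarrow> 0"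
    proof (rule tendsto_divide_0[OF tendsto_const])
      have "filterlim (\<lambda>n. 2 * sqrt (real (Suc n))) at_top sequentially"
        by (intro filterlim_tendsto_pos_mult_at_top[OF tendsto_const]
            filterlim_compose[OF sqrt_at_top] filterlim_compose[OF filterlim_real_sequentially]
            filterlim_Suc) simp
      then show "filterlim (\<lambda>n. 2 * sqrt (real (Suc n))) at_infinity sequentially"
        by (rule filterlim_at_top_imp_at_infinity)
    qed
    ultimately have "R \<longlonglongrightarrow> 0" by (rule Lim_null_comparison)
    then show ?thesis using R1 LIMSEQ_unique by blast
  qed
  have "qc u v + of_real \<alpha> * cinner_l2 u v = cinner_l2 f v" if v: "v \<in> Dc" for v
  proof -
    have uD: "u \<in> Dc" using ap by (rule closure_domI)
    have iv: "scaleC_l2 \<i> v \<in> Dc" using v by (rule closure_dom_scaleC)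
    have "qc u (scaleC_l2 \<i> v) = - \<i> * qc u v"
      using closure_form_hermitian[OF iv uD] closure_form_hermitian[OF v uD]
      by (simp add: closure_form_scaleC_left[OF v uD])
    \<comment> \<open>the variation in the direction \<open>\<i> v\<close> supplies the imaginary part\<close>
    then have "Im (qc u v + of_real \<alpha> * cinner_l2 u v - cinner_l2 f v) = 0"
      using re[OF iv] by (simp add: cinner_l2_scaleC_right)
    with re[OF v] show ?thesis by (simp add: complex_eq_iff)
  qed
  then have "resolvent_eq \<alpha> f u" using closure_domI[OF ap] by (simp add: resolvent_eq_def)
  then show ?thesis by blast
qed

subsection \<open>The resolvent as a bounded self-adjoint operator\<close>

abbreviation resolvent :: "real \<Rightarrow> 'n l2 \<Rightarrow> 'n l2" where
  "resolvent \<alpha> \<equiv> op_inverse (plus_scalar (form_operator Dc qc) \<alpha>)"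

lemma resolvent_eq_iff:
  assumes "\<alpha> > 0"
  shows "resolvent_eq \<alpha> f u \<longleftrightarrow> u = resolvent \<alpha> f"
proof -
  obtain w where w: "resolvent_eq \<alpha> f w" using resolvent_eq_exists[OF assms] by blast
  have "resolvent \<alpha> f = w"
    unfolding op_inverse_def plus_scalar_form_operator_iff
    by (rule the_equality) (rule w, erule resolvent_eq_unique[OF _ w assms])
  then show ?thesis using w resolvent_eq_unique[OF _ w assms] by metis
qed

lemma resolvent_is_bounded_inverse:
  assumes "\<alpha> > 0"
  shows "is_bounded_inverse (plus_scalar (form_operator Dc qc) \<alpha>) (resolvent \<alpha>)"
  unfolding is_bounded_inverse_def plus_scalar_form_operator_iff
proof
  note sol = resolvent_eq_iff[OF assms, THEN iffD2, OF refl]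
  show "bounded_linear (resolvent \<alpha>)"
  proof (rule bounded_linear_intro[where K="1 / \<alpha>"])
    show "resolvent \<alpha> (f + g) = resolvent \<alpha> f + resolvent \<alpha> g" for f g
      using resolvent_eq_add[OF sol sol] by (simp add: resolvent_eq_iff[OF assms])
    show "resolvent \<alpha> (r *\<^sub>R f) = r *\<^sub>R resolvent \<alpha> f" for r f
      using resolvent_eq_scaleC[OF sol, of "of_real r"]
      by (simp add: resolvent_eq_iff[OF assms] scaleC_l2_of_real)
    show "norm (resolvent \<alpha> f) \<le> norm f * (1 / \<alpha>)" for f
      using resolvent_bounds(1)[OF sol assms] by simp
  qed
  show "\<forall>u f. resolvent_eq \<alpha> f u \<longleftrightarrow> u = resolvent \<alpha> f"
    using resolvent_eq_iff[OF assms] by blast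
qed

text \<open>Testing the equation for \<open>f\<close> with the solution for \<open>g\<close> and conversely expresses both inner
  products by the same Hermitian form. The description of the adjoint has no other solution because
  a vector is determined by its inner products.\<close>

lemma adjoint_resolvent:
  assumes "\<alpha> > 0"
  shows "adjoint_l2 (resolvent \<alpha>) = resolvent \<alpha>"
proof -
  have sym: "cinner_l2 (resolvent \<alpha> f) g = cinner_l2 f (resolvent \<alpha> g)" for f g
  proof -
    let ?u = "resolvent \<alpha> f" and ?v = "resolvent \<alpha> g"
    have u: "?u \<in> Dc" "\<And>v. v \<in> Dc \<Longrightarrow> qc ?u v + of_real \<alpha> * cinner_l2 ?u v = cinner_l2 f v"
      using resolvent_eq_iff[OF assms, of f ?u] by (auto simp: resolvent_eq_def)
    have v: "?v \<in> Dc" "\<And>u. u \<in> Dc \<Longrightarrow> qc ?v u + of_real \<alpha> * cinner_l2 ?v u = cinner_l2 g u"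
      using resolvent_eq_iff[OF assms, of g ?v] by (auto simp: resolvent_eq_def)
    have "cinner_l2 ?u g = cnj (cinner_l2 g ?u)" by (rule cinner_l2_commute)
    also have "\<dots> = qc ?u ?v + of_real \<alpha> * cinner_l2 ?u ?v"
      using closure_form_hermitian[OF v(1) u(1)] cinner_l2_commute[of ?u ?v]
      by (simp add: v(2)[OF u(1), symmetric])
    also have "\<dots> = cinner_l2 f ?v" by (rule u(2)[OF v(1)])
    finally show ?thesis .
  qed
  show ?thesis
    unfolding adjoint_l2_def
  proof (rule the_equality)
    show "\<forall>f g. cinner_l2 (resolvent \<alpha> f) g = cinner_l2 f (resolvent \<alpha> g)" using sym by blast
    show "B = resolvent \<alpha>" if "\<forall>f g. cinner_l2 (resolvent \<alpha> f) g = cinner_l2 f (B g)" for B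
      using that sym by (intro ext cinner_l2_ext) metis
  qed
qed

text \<open>Any bound of a bounded operator by the form passes from the core to the range of the
  resolvent, where the form is at most \<open>\<parallel>f\<parallel>\<^sup>2 / \<alpha>\<close>.\<close>

lemma onorm_comp_resolvent_le:
  assumes T: "bounded_linear T" and K: "K \<ge> 0" and \<alpha>: "\<alpha> > 0"
    and core: "\<And>v. v \<in> D \<Longrightarrow> norm (T v) \<le> K * sqrt (Q v)"
  shows "onorm (\<lambda>f. T (resolvent \<alpha> f)) \<le> K / sqrt \<alpha>"
proof (rule onorm_bound)
  fix f
  have sol: "resolvent_eq \<alpha> f (resolvent \<alpha> f)" using resolvent_eq_iff[OF \<alpha>] by blast
  then obtain \<phi> where \<phi>: "form_approx D q \<phi> (resolvent \<alpha> f)"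
    using closure_domE unfolding resolvent_eq_def by blast
  have "norm (T (resolvent \<alpha> f)) \<le> K * sqrt (Re (qc (resolvent \<alpha> f) (resolvent \<alpha> f)))"
  proof (rule LIMSEQ_le)
    show "(\<lambda>n. norm (T (\<phi> n))) \<longlonglongrightarrow> norm (T (resolvent \<alpha> f))"
      using \<phi> by (intro tendsto_norm bounded_linear.tendsto[OF T]) (simp add: form_approx_iff)
    show "(\<lambda>n. K * sqrt (Q (\<phi> n))) \<longlonglongrightarrow> K * sqrt (Re (qc (resolvent \<alpha> f) (resolvent \<alpha> f)))"
      by (intro tendsto_intros closure_form_tendsto \<phi>)
    show "\<exists>N. \<forall>n\<ge>N. norm (T (\<phi> n)) \<le> K * sqrt (Q (\<phi> n))"
      using \<phi> core by (auto simp: form_approx_iff)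
  qed
  also have "\<dots> \<le> K * sqrt ((norm f)\<^sup>2 / \<alpha>)"
    by (intro mult_left_mono real_sqrt_le_mono resolvent_bounds(2)[OF sol \<alpha>] K)
  also have "\<dots> = K / sqrt \<alpha> * norm f" by (simp add: real_sqrt_divide)
  finally show "norm (T (resolvent \<alpha> f)) \<le> K / sqrt \<alpha> * norm f" .
qed (use K \<alpha> in simp)

end

section \<open>Compactly supported differentiable functions\<close>

lemma partial_deriv_eqI: "(f has_derivative f') (at x) \<Longrightarrow> partial_deriv i f x = f' (axis i 1)"
  unfolding partial_deriv_def by (metis frechet_derivative_at)

lemma C_1_iff:
  "C_k 1 f \<longleftrightarrow> (\<forall>x. f differentiable (at x)) \<and> (\<forall>i. continuous_on UNIV (partial_deriv i f))"
  by simp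

lemma C_1_continuous: "C_k 1 f \<Longrightarrow> continuous_on UNIV f"
  by (simp add: differentiable_imp_continuous_on differentiable_on_def
      differentiable_at_imp_differentiable_on)

lemma frechet_derivative_eq_sum_partial:
  fixes f :: "real^'n \<Rightarrow> 'b::real_normed_vector"
  assumes "f differentiable (at x)"
  shows "frechet_derivative f (at x) s = (\<Sum>i\<in>UNIV. (s $ i) *\<^sub>R partial_deriv i f x)"
proof -
  have lin: "linear (frechet_derivative f (at x))"
    by (rule linear_frechet_derivative[OF assms])
  have "s = (\<Sum>i\<in>UNIV. (s $ i) *\<^sub>R axis i 1)"
    using basis_expansion[of s] by (simp add: scalar_mult_eq_scaleR)
  then have "frechet_derivative f (at x) s
      = frechet_derivative f (at x) (\<Sum>i\<in>UNIV. (s $ i) *\<^sub>R axis i 1)" by simp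
  then show ?thesis by (simp add: linear_sum[OF lin] linear_scale[OF lin] partial_deriv_def)
qed

lemma norm_frechet_derivative_le:
  fixes f :: "real^'n \<Rightarrow> 'b::real_normed_vector"
  assumes "f differentiable (at x)"
  shows "(norm (frechet_derivative f (at x) s))\<^sup>2
    \<le> (norm s)\<^sup>2 * (\<Sum>i\<in>UNIV. (norm (partial_deriv i f x))\<^sup>2)"
proof -
  have "norm (frechet_derivative f (at x) s) \<le> (\<Sum>i\<in>UNIV. \<bar>s $ i\<bar> * \<bar>norm (partial_deriv i f x)\<bar>)"
    unfolding frechet_derivative_eq_sum_partial[OF assms]
    by (rule order_trans[OF norm_sum]) simp
  also have "\<dots> \<le> L2_set (\<lambda>i. s $ i) UNIV * L2_set (\<lambda>i. norm (partial_deriv i f x)) UNIV"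
    by (rule L2_set_mult_ineq)
  also have "L2_set (\<lambda>i. s $ i) UNIV = norm s"
    by (simp add: norm_vec_def L2_set_def)
  finally have "(norm (frechet_derivative f (at x) s))\<^sup>2
      \<le> (norm s * L2_set (\<lambda>i. norm (partial_deriv i f x)) UNIV)\<^sup>2"
    by (rule power_mono) simp
  then show ?thesis by (simp add: power_mult_distrib L2_set_def sum_nonneg)
qed

lemma bounded_support_partial_deriv:
  assumes "bounded {x. f x \<noteq> 0}"
  shows "bounded {x. partial_deriv i f x \<noteq> 0}"
proof (rule bounded_subset[OF bounded_closure[OF assms]])
  show "{x. partial_deriv i f x \<noteq> 0} \<subseteq> closure {x. f x \<noteq> 0}"
  proof (rule subsetI, rule ccontr)
    fix x assume x: "x \<in> {x. partial_deriv i f x \<noteq> 0}" "x \<notin> closure {x. f x \<noteq> 0}"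
    have "(f has_derivative (\<lambda>h. 0)) (at x)"
    proof (rule has_derivative_transform_within_open)
      show "((\<lambda>x. 0) has_derivative (\<lambda>h. 0)) (at x)" by simp
      show "open (- closure {x. f x \<noteq> 0})" by auto
      show "0 = f y" if "y \<in> - closure {x. f x \<noteq> 0}" for y
        using that closure_subset[of "{x. f x \<noteq> 0}"] by auto
    qed (use x in auto)
    then show False using x(1) partial_deriv_eqI[of f "\<lambda>h. 0" x i] by simp
  qed
qed

lemma bounded_support_integrable:
  fixes f :: "real^'n \<Rightarrow> 'b::{banach, second_countable_topology}"
  assumes "continuous_on UNIV f" "bounded {x. f x \<noteq> 0}"
  shows "integrable lborel f"
proof -
  let ?K = "closure {x. f x \<noteq> 0}"
  have "integrable lborel (\<lambda>x. indicator ?K x *\<^sub>R f x)"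
    by (rule borel_integrable_compact)
      (use assms in \<open>auto simp: compact_closure intro: continuous_on_subset\<close>)
  also have "(\<lambda>x. indicator ?K x *\<^sub>R f x) = f"
    using closure_subset[of "{x. f x \<noteq> 0}"] by (intro ext) (auto simp: indicator_def)
  finally show ?thesis .
qed

lemma bounded_support_sq_integrable:
  assumes "continuous_on UNIV f" "bounded {x. f x \<noteq> 0}"
  shows "sq_integrable f"
  unfolding sq_integrable_def
proof
  show "integrable lborel (\<lambda>x. (cmod (f x))\<^sup>2)"
    by (rule bounded_support_integrable) (use assms in \<open>auto intro!: continuous_intros\<close>)
qed (use assms in \<open>simp add: borel_measurable_continuous_onI\<close>)

lemma bounded_support_bounded:
  fixes f :: "real^'n \<Rightarrow> 'b::real_normed_vector"
  assumes "continuous_on UNIV f" "bounded {x. f x \<noteq> 0}"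
  obtains M where "M \<ge> 0" "\<And>x. norm (f x) \<le> M"
proof -
  let ?K = "closure {x. f x \<noteq> 0}"
  have "compact (f ` ?K)"
    by (rule compact_continuous_image)
      (use assms in \<open>auto simp: compact_closure intro: continuous_on_subset\<close>)
  then obtain M where M: "\<And>x. x \<in> ?K \<Longrightarrow> norm (f x) \<le> M"
    using compact_imp_bounded bounded_iff by (metis imageI)
  have "norm (f x) \<le> max M 0" for x
    using M[of x] closure_subset[of "{x. f x \<noteq> 0}"] by (cases "f x = 0") auto
  then show thesis using that[of "max M 0"] by simp
qed

text \<open>The partial derivatives are continuous with compact support, hence bounded, and the mean value
  inequality applies. The constant serves as the dominating bound for difference quotients.\<close>

lemma C_1_bounded_support_Lipschitz:
  fixes f :: "real^'n \<Rightarrow> 'b::real_normed_vector"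
  assumes f: "C_k 1 f" and supp: "bounded {x. f x \<noteq> 0}"
  obtains B where "B \<ge> 0" "\<And>x y. norm (f x - f y) \<le> B * norm (x - y)"
proof -
  have "\<exists>M. M \<ge> 0 \<and> (\<forall>x. norm (partial_deriv i f x) \<le> M)" for i
    using bounded_support_bounded[OF _ bounded_support_partial_deriv[OF supp, of i]] f
    unfolding C_1_iff by metis
  then obtain M where M: "\<And>i. M i \<ge> 0" "\<And>i x. norm (partial_deriv i f x) \<le> M i" by metis
  define B where "B = (\<Sum>i\<in>UNIV. M i)"
  have B: "B \<ge> 0" unfolding B_def by (rule sum_nonneg) (rule M)
  have "norm (f x - f y) \<le> B * norm (x - y)" for x y
  proof (rule differentiable_bound)
    fix z
    have d: "f differentiable (at z)" using f unfolding C_1_iff by blast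
    show "(f has_derivative frechet_derivative f (at z)) (at z within UNIV)"
      using d by (simp add: frechet_derivative_works)
    show "onorm (frechet_derivative f (at z)) \<le> B"
    proof (rule onorm_bound[OF B])
      fix s
      have "norm (frechet_derivative f (at z) s) \<le> (\<Sum>i\<in>UNIV. norm (s $ i *\<^sub>R partial_deriv i f z))"
        unfolding frechet_derivative_eq_sum_partial[OF d] by (rule norm_sum)
      also have "\<dots> \<le> (\<Sum>i\<in>UNIV. norm s * M i)"
      proof (rule sum_mono)
        fix i
        show "norm (s $ i *\<^sub>R partial_deriv i f z) \<le> norm s * M i"
          using mult_mono[OF component_le_norm_cart[of s i] M(2)[of i z]] by simp
      qed
      finally show "norm (frechet_derivative f (at z) s) \<le> B * norm s"
        by (simp add: B_def sum_distrib_left mult.commute)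
    qed
  qed auto
  then show thesis using that B by blast
qed

subsection \<open>Difference quotients\<close>

definition diff_quot :: "(real^'n \<Rightarrow> 'b::real_normed_vector) \<Rightarrow> real^'n \<Rightarrow> nat \<Rightarrow> real^'n \<Rightarrow> 'b" where
  "diff_quot f s n x = real (Suc n) *\<^sub>R (f (x + s /\<^sub>R real (Suc n)) - f x)"

lemma diff_quot_tendsto:
  assumes "f differentiable (at x)"
  shows "(\<lambda>n. diff_quot f s n x) \<longlonglongrightarrow> frechet_derivative f (at x) s"
proof (cases "s = 0")
  case True
  then show ?thesis
    using linear_0[OF linear_frechet_derivative[OF assms]] by (simp add: diff_quot_def)
next
  case False
  let ?D = "frechet_derivative f (at x)"
  define h where "h n = s /\<^sub>R real (Suc n)" for n
  have h_nz: "h n \<noteq> 0" for n using False by (simp add: h_def)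
  have hs: "h \<longlonglongrightarrow> 0"
    using tendsto_scaleR[OF LIMSEQ_inverse_real_of_nat tendsto_const[of s]]
    by (simp add: h_def[abs_def])
  have "((\<lambda>y. norm (f (x + y) - f x - ?D y) / norm y) \<longlongrightarrow> 0) (at 0)"
    using assms by (simp add: frechet_derivative_works has_derivative_at)
  then have "(\<lambda>n. norm (f (x + h n) - f x - ?D (h n)) / norm (h n)) \<longlonglongrightarrow> 0"
    by (rule filterlim_compose) (use hs h_nz in \<open>simp add: filterlim_at\<close>)
  moreover have "norm (f (x + h n) - f x - ?D (h n)) / norm (h n)
      = norm (diff_quot f s n x - ?D s) / norm s" for n
  proof -
    have "?D s = real (Suc n) *\<^sub>R ?D (h n)"
      using linear_scale[OF linear_frechet_derivative[OF assms], of "real (Suc n)" "h n"]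
      by (simp add: h_def del: of_nat_Suc)
    then have "diff_quot f s n x - ?D s = real (Suc n) *\<^sub>R (f (x + h n) - f x - ?D (h n))"
      by (simp add: diff_quot_def h_def scaleR_diff_right del: of_nat_Suc)
    then have "norm (diff_quot f s n x - ?D s) = real (Suc n) * norm (f (x + h n) - f x - ?D (h n))"
      by (simp del: of_nat_Suc)
    moreover have "norm s = real (Suc n) * norm (h n)" by (simp add: h_def del: of_nat_Suc)
    ultimately show ?thesis by (simp del: of_nat_Suc)
  qed
  ultimately have "(\<lambda>n. norm (diff_quot f s n x - ?D s) / norm s * norm s) \<longlonglongrightarrow> 0 * norm s"
    by (intro tendsto_mult tendsto_const) simp
  then have "(\<lambda>n. norm (diff_quot f s n x - ?D s)) \<longlonglongrightarrow> 0" using False by simp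
  then show ?thesis by (simp add: tendsto_norm_zero_iff LIM_zero_iff)
qed

text \<open>The steps \<open>s / (n + 1)\<close> have length at most \<open>|s|\<close>, so all difference quotients live in the
  \<open>|s|\<close>-neighbourhood of the support.\<close>

lemma diff_quot_dominated:
  fixes f :: "real^'n \<Rightarrow> 'b::real_normed_vector"
  assumes f: "C_k 1 f" and supp: "bounded {x. f x \<noteq> 0}"
  obtains M R where "M \<ge> 0" "\<And>n x. norm (diff_quot f s n x) \<le> M * indicator (cball 0 R) x"
proof -
  obtain B where B: "B \<ge> 0" "\<And>x y. norm (f x - f y) \<le> B * norm (x - y)"
    using C_1_bounded_support_Lipschitz[OF f supp] by blast
  obtain R where R: "\<And>x. f x \<noteq> 0 \<Longrightarrow> norm x \<le> R"
    using supp unfolding bounded_iff by blast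
  have "norm (diff_quot f s n x) \<le> B * norm s * indicator (cball 0 (R + norm s)) x" for n x
  proof (cases "norm x \<le> R + norm s")
    case True
    have "norm (diff_quot f s n x) \<le> real (Suc n) * (B * norm (x + s /\<^sub>R real (Suc n) - x))"
      unfolding diff_quot_def norm_scaleR using B(2)[of "x + s /\<^sub>R real (Suc n)" x]
      by (simp only: abs_of_nat) (rule mult_left_mono, auto)
    also have "\<dots> = B * norm s" by (simp del: of_nat_Suc)
    finally show ?thesis using True by simp
  next
    case False
    have "norm (s /\<^sub>R real (Suc n)) \<le> norm s"
      by (simp add: field_simps mult_le_cancel_right1)
    moreover have "norm x \<le> norm (x + s /\<^sub>R real (Suc n)) + norm (s /\<^sub>R real (Suc n))"
      using norm_triangle_ineq4[of "x + s /\<^sub>R real (Suc n)" "s /\<^sub>R real (Suc n)"]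
      by (simp only: add_diff_cancel_right')
    ultimately have "norm (x + s /\<^sub>R real (Suc n)) > R" "norm x > R"
      using False norm_ge_zero[of s] by linarith+
    then have "f (x + s /\<^sub>R real (Suc n)) = 0" "f x = 0" using R by force+
    then show ?thesis using False by (simp add: diff_quot_def)
  qed
  then show thesis using that[of "B * norm s" "R + norm s"] B(1) by simp
qed

lemma borel_measurable_diff_quot:
  assumes "continuous_on UNIV f"
  shows "diff_quot f s n \<in> borel_measurable borel"
  unfolding diff_quot_def
  by (intro borel_measurable_continuous_onI continuous_intros
      continuous_on_compose2[OF assms]) (auto intro: continuous_intros assms)

lemma borel_measurable_frechet_derivative:
  fixes f :: "real^'n \<Rightarrow> 'b::real_normed_vector"
  assumes "C_k 1 f"
  shows "(\<lambda>x. frechet_derivative f (at x) s) \<in> borel_measurable borel"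
proof -
  have d: "f differentiable (at x)" for x using assms unfolding C_1_iff by blast
  have "continuous_on UNIV (\<lambda>x. \<Sum>i\<in>UNIV. (s $ i) *\<^sub>R partial_deriv i f x)"
    using assms unfolding C_1_iff by (intro continuous_intros) auto
  then show ?thesis
    by (simp add: frechet_derivative_eq_sum_partial[OF d] borel_measurable_continuous_onI)
qed

text \<open>Lebesgue measure is translation invariant, so difference quotients integrate to zero; let
  the step tend to zero.\<close>

lemma integral_partial_deriv_eq_0:
  fixes f :: "real^'n \<Rightarrow> complex"
  assumes f: "C_k 1 f" and supp: "bounded {x. f x \<noteq> 0}"
  shows "(\<integral>x. partial_deriv i f x \<partial>lborel) = 0"
proof -
  let ?s = "axis i 1 :: real^'n"
  have cont: "continuous_on UNIV f" by (rule C_1_continuous[OF f])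
  have fm: "f \<in> borel_measurable borel" by (rule borel_measurable_continuous_onI[OF cont])
  have int: "integrable lborel f" by (rule bounded_support_integrable[OF cont supp])
  obtain M R where M: "M \<ge> 0" "\<And>n x. norm (diff_quot f ?s n x) \<le> M * indicator (cball 0 R) x"
    using diff_quot_dominated[OF f supp, of ?s] by blast
  have "(\<lambda>n. \<integral>x. diff_quot f ?s n x \<partial>lborel) \<longlonglongrightarrow> (\<integral>x. frechet_derivative f (at x) ?s \<partial>lborel)"
  proof (rule integral_dominated_convergence)
    show "(\<lambda>x. frechet_derivative f (at x) ?s) \<in> borel_measurable lborel"
      using borel_measurable_frechet_derivative[OF f] by simp
    show "diff_quot f ?s n \<in> borel_measurable lborel" for n
      using borel_measurable_diff_quot[OF cont] by simp
    show "integrable lborel (\<lambda>x. M * indicator (cball 0 R :: (real^'n) set) x)"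
      by (intro integrable_mult_right integrable_real_indicator)
        (use emeasure_bounded_finite[OF bounded_cball] in simp_all)
    show "AE x in lborel. (\<lambda>n. diff_quot f ?s n x) \<longlonglongrightarrow> frechet_derivative f (at x) ?s"
      using f unfolding C_1_iff by (intro AE_I2 diff_quot_tendsto) auto
  qed (use M in auto)
  moreover have "(\<integral>x. diff_quot f ?s n x \<partial>lborel) = 0" for n
  proof -
    have "integrable lborel (\<lambda>x. f (x + t))" for t
    proof (rule bounded_support_integrable)
      show "continuous_on UNIV (\<lambda>x. f (x + t))"
        by (intro continuous_on_compose2[OF cont] continuous_intros) auto
      have "{x. f (x + t) \<noteq> 0} = (\<lambda>x. x - t) ` {x. f x \<noteq> 0}"
        by (force simp: image_iff)
      then show "bounded {x. f (x + t) \<noteq> 0}"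
        using bounded_translation_minus[OF supp] by simp
    qed
    then show ?thesis
      unfolding diff_quot_def
      using int lborel_integral_translate[OF fm] by simp
  qed
  ultimately show ?thesis by (simp add: partial_deriv_def LIMSEQ_const_iff)
qed

subsection \<open>Translations are Lipschitz in the Dirichlet norm\<close>

text \<open>Cutting a translation into \<open>k\<close> equal steps costs nothing because translations are isometries.\<close>

lemma norm_translate_diff_le_mult:
  "norm (translate_l2 (real k *\<^sub>R h) u - u) \<le> real k * norm (translate_l2 h u - u)"
proof (induction k)
  case 0
  have "translate_l2 0 u = u"
    using translate_abs_l2[OF sq_integrable_rep_l2, of 0 u] by (simp add: abs_rep_l2)
  then show ?case by simp
next
  case (Suc k)
  let ?T = "translate_l2 h"
  note lin = bounded_linear.linear[OF bounded_linear_translate_l2]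
  have "translate_l2 (real (Suc k) *\<^sub>R h) u = ?T (translate_l2 (real k *\<^sub>R h) u)"
    by (simp add: translate_l2_add scaleR_left_distrib)
  then have "translate_l2 (real (Suc k) *\<^sub>R h) u - u
      = ?T (translate_l2 (real k *\<^sub>R h) u - u) + (?T u - u)"
    by (simp add: linear_diff[OF lin])
  then have "norm (translate_l2 (real (Suc k) *\<^sub>R h) u - u)
      \<le> norm (?T (translate_l2 (real k *\<^sub>R h) u - u)) + norm (?T u - u)"
    by (metis norm_triangle_ineq)
  also have "\<dots> \<le> real k * norm (?T u - u) + norm (?T u - u)"
    using Suc by (simp add: norm_translate_l2)
  finally show ?case by (simp add: algebra_simps)
qed

text \<open>Take \<open>n + 1\<close> steps of size \<open>s / (n + 1)\<close>: the bound obtained is the norm of the difference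
  quotient, which tends to the norm of the directional derivative. This gives the constant one
  without integrating along the segment from \<open>x\<close> to \<open>x + s\<close>.\<close>

lemma norm_translate_diff_le_derivative:
  fixes f :: "real^'n \<Rightarrow> complex"
  assumes f: "C_k 1 f" and supp: "bounded {x. f x \<noteq> 0}"
  shows "(norm (translate_l2 s (abs_l2 f) - abs_l2 f))\<^sup>2
    \<le> (\<integral>x. (cmod (frechet_derivative f (at x) s))\<^sup>2 \<partial>lborel)"
proof (rule LIMSEQ_le_const)
  have cont: "continuous_on UNIV f" by (rule C_1_continuous[OF f])
  have sq: "sq_integrable f" by (rule bounded_support_sq_integrable[OF cont supp])
  note [measurable] = borel_measurable_diff_quot[OF cont] borel_measurable_frechet_derivative[OF f]
  obtain M R where M: "M \<ge> 0" "\<And>n x. norm (diff_quot f s n x) \<le> M * indicator (cball 0 R) x"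
    using diff_quot_dominated[OF f supp] by blast
  show "(\<lambda>n. \<integral>x. (cmod (diff_quot f s n x))\<^sup>2 \<partial>lborel)
      \<longlonglongrightarrow> (\<integral>x. (cmod (frechet_derivative f (at x) s))\<^sup>2 \<partial>lborel)"
  proof (rule integral_dominated_convergence)
    show "integrable lborel (\<lambda>x. M\<^sup>2 * indicator (cball 0 R :: (real^'n) set) x)"
      by (intro integrable_mult_right integrable_real_indicator)
        (use emeasure_bounded_finite[OF bounded_cball] in simp_all)
    show "AE x in lborel. (\<lambda>n. (cmod (diff_quot f s n x))\<^sup>2)
        \<longlonglongrightarrow> (cmod (frechet_derivative f (at x) s))\<^sup>2"
      using f unfolding C_1_iff by (intro AE_I2 tendsto_intros diff_quot_tendsto) auto
    have "(cmod (diff_quot f s n x))\<^sup>2 \<le> M\<^sup>2 * indicator (cball 0 R) x" for n x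
      using power_mono[OF M(2) norm_ge_zero, of n x 2]
      by (cases "x \<in> cball 0 R") (auto simp: power_mult_distrib)
    then show "AE x in lborel. norm ((cmod (diff_quot f s n x))\<^sup>2) \<le> M\<^sup>2 * indicator (cball 0 R) x" for n
      by simp
  qed simp_all
  have "(norm (translate_l2 s (abs_l2 f) - abs_l2 f))\<^sup>2
      \<le> (\<integral>x. (cmod (diff_quot f s n x))\<^sup>2 \<partial>lborel)" for n
  proof -
    let ?h = "s /\<^sub>R real (Suc n)"
    have "norm (translate_l2 s (abs_l2 f) - abs_l2 f)
        \<le> real (Suc n) * norm (translate_l2 ?h (abs_l2 f) - abs_l2 f)"
      using norm_translate_diff_le_mult[of "Suc n" ?h "abs_l2 f"] by (simp del: of_nat_Suc)
    also have "\<dots> = norm (real (Suc n) *\<^sub>R (translate_l2 ?h (abs_l2 f) - abs_l2 f))"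
      by (simp del: of_nat_Suc)
    also have "real (Suc n) *\<^sub>R (translate_l2 ?h (abs_l2 f) - abs_l2 f) = abs_l2 (diff_quot f s n)"
      using sq_integrable_diff[OF sq_integrable_translate[OF sq] sq]
      by (simp add: translate_abs_l2 sq abs_l2_diff sq_integrable_translate abs_l2_scaleR
          diff_quot_def[abs_def] scaleR_conv_of_real del: of_nat_Suc)
    finally have "(norm (translate_l2 s (abs_l2 f) - abs_l2 f))\<^sup>2 \<le> (norm (abs_l2 (diff_quot f s n)))\<^sup>2"
      by (rule power_mono) simp
    also have "\<dots> = (\<integral>x. (cmod (diff_quot f s n x))\<^sup>2 \<partial>lborel)"
    proof (rule norm_abs_l2)
      show "sq_integrable (diff_quot f s n)"
        using sq_integrable_scale[OF sq_integrable_diff[OF sq_integrable_translate[OF sq] sq]]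
        by (simp add: diff_quot_def[abs_def] scaleR_conv_of_real del: of_nat_Suc)
    qed
    finally show ?thesis .
  qed
  then show "\<exists>N. \<forall>n\<ge>N. (norm (translate_l2 s (abs_l2 f) - abs_l2 f))\<^sup>2
      \<le> (\<integral>x. (cmod (diff_quot f s n x))\<^sup>2 \<partial>lborel)" by blast
qed

lemma norm_translate_diff_le_dirichlet:
  fixes f :: "real^'n \<Rightarrow> complex"
  assumes f: "C_k 1 f" and supp: "bounded {x. f x \<noteq> 0}"
    and a: "continuous_on UNIV a" and c: "c > 0" "\<And>x. c \<le> a x"
  shows "norm (translate_l2 s (abs_l2 f) - abs_l2 f)
    \<le> norm s / sqrt c * sqrt (Re (dirichlet_form a f f))"
proof -
  define G where "G x = (\<Sum>i\<in>UNIV. (cmod (partial_deriv i f x))\<^sup>2)" for x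
  have pc: "continuous_on UNIV (partial_deriv i f)" for i using f unfolding C_1_iff by blast
  have Gc: "continuous_on UNIV G" unfolding G_def by (intro continuous_intros pc)
  have "{x. G x \<noteq> 0} \<subseteq> (\<Union>i. {x. partial_deriv i f x \<noteq> 0})"
    by (force simp: G_def sum_nonneg_eq_0_iff)
  then have Gs: "bounded {x. G x \<noteq> 0}"
    by (rule bounded_subset[rotated]) (intro bounded_UN finite ballI bounded_support_partial_deriv supp)
  have Gi: "integrable lborel G" by (rule bounded_support_integrable[OF Gc Gs])
  have aGi: "integrable lborel (\<lambda>x. a x * G x)"
    by (rule bounded_support_integrable) (intro continuous_intros a Gc, rule bounded_subset[OF Gs], auto)
  have G0: "G x \<ge> 0" for x unfolding G_def by (rule sum_nonneg) simp
  have "(norm (translate_l2 s (abs_l2 f) - abs_l2 f))\<^sup>2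
      \<le> (\<integral>x. (cmod (frechet_derivative f (at x) s))\<^sup>2 \<partial>lborel)"
    by (rule norm_translate_diff_le_derivative[OF f supp])
  also have "\<dots> \<le> (\<integral>x. ((norm s)\<^sup>2 / c) * (a x * G x) \<partial>lborel)"
  proof (rule Bochner_Integration.integral_mono')
    show "integrable lborel (\<lambda>x. ((norm s)\<^sup>2 / c) * (a x * G x))"
      by (intro integrable_mult_right aGi)
    fix x
    have "(cmod (frechet_derivative f (at x) s))\<^sup>2 \<le> (norm s)\<^sup>2 * G x"
      unfolding G_def by (rule norm_frechet_derivative_le) (use f in \<open>simp add: C_1_iff\<close>)
    also have "\<dots> = ((norm s)\<^sup>2 / c) * (c * G x)" using c by simp
    also have "\<dots> \<le> ((norm s)\<^sup>2 / c) * (a x * G x)"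
      by (intro mult_left_mono mult_right_mono c G0) (use c in auto)
    finally show "(cmod (frechet_derivative f (at x) s))\<^sup>2 \<le> ((norm s)\<^sup>2 / c) * (a x * G x)" .
    show "0 \<le> ((norm s)\<^sup>2 / c) * (a x * G x)"
      using c(1) order_trans[OF less_imp_le[OF c(1)] c(2)[of x]] G0[of x] by simp
  qed
  also have "\<dots> = (norm s)\<^sup>2 / c * Re (dirichlet_form a f f)"
    by (simp add: dirichlet_form_diag G_def)
  finally have "sqrt ((norm (translate_l2 s (abs_l2 f) - abs_l2 f))\<^sup>2)
      \<le> sqrt ((norm s)\<^sup>2 / c * Re (dirichlet_form a f f))"
    by (rule real_sqrt_le_mono)
  then show ?thesis by (simp add: real_sqrt_mult real_sqrt_divide)
qed

section \<open>The Dirichlet form on test functions\<close>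

lemma
  fixes f :: "real^'n \<Rightarrow> 'b::real_normed_vector" and g :: "real^'n \<Rightarrow> 'c::real_normed_vector"
  assumes p: "bounded_bilinear p" and f: "f differentiable (at x)" and g: "g differentiable (at x)"
  shows differentiable_bilinear: "(\<lambda>x. p (f x) (g x)) differentiable (at x)"
    and partial_deriv_bilinear:
      "partial_deriv i (\<lambda>x. p (f x) (g x)) x = p (f x) (partial_deriv i g x) + p (partial_deriv i f x) (g x)"
proof -
  have "((\<lambda>x. p (f x) (g x)) has_derivative
      (\<lambda>h. p (f x) (frechet_derivative g (at x) h) + p (frechet_derivative f (at x) h) (g x))) (at x)"
    by (rule bounded_bilinear.FDERIV[OF p]) (use f g in \<open>simp_all add: frechet_derivative_works\<close>)
  then show "(\<lambda>x. p (f x) (g x)) differentiable (at x)"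
    "partial_deriv i (\<lambda>x. p (f x) (g x)) x = p (f x) (partial_deriv i g x) + p (partial_deriv i f x) (g x)"
    by (auto simp: differentiable_def partial_deriv_eqI partial_deriv_def[symmetric])
qed

lemma C_1_bilinear:
  fixes f :: "real^'n \<Rightarrow> 'b::real_normed_vector" and g :: "real^'n \<Rightarrow> 'c::real_normed_vector"
  assumes p: "bounded_bilinear p" and f: "C_k 1 f" and g: "C_k 1 g"
  shows "C_k 1 (\<lambda>x. p (f x) (g x))"
proof -
  have d: "f differentiable (at x)" "g differentiable (at x)" for x
    using f g unfolding C_1_iff by auto
  have "partial_deriv i (\<lambda>x. p (f x) (g x))
      = (\<lambda>x. p (f x) (partial_deriv i g x) + p (partial_deriv i f x) (g x))" for i
    by (rule ext) (rule partial_deriv_bilinear[OF p d])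
  moreover have "continuous_on UNIV
      (\<lambda>x. p (f x) (partial_deriv i g x) + p (partial_deriv i f x) (g x))" for i
    using f g C_1_continuous[OF f] C_1_continuous[OF g] unfolding C_1_iff
    by (intro continuous_on_add bounded_bilinear.continuous_on[OF p]) auto
  ultimately show ?thesis
    unfolding C_1_iff using differentiable_bilinear[OF p d] by auto
qed

lemma bounded_bilinear_mult_cnj: "bounded_bilinear (\<lambda>u v :: complex. u * cnj v)"
  using bounded_bilinear.comp[OF bounded_bilinear_mult bounded_linear_ident bounded_linear_cnj]
  by simp

lemma partial_deriv_add:
  assumes "f differentiable (at x)" "g differentiable (at x)"
  shows "partial_deriv i (\<lambda>x. f x + g x) x = partial_deriv i f x + partial_deriv i g x"
proof -
  have "((\<lambda>x. f x + g x) has_derivative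
      (\<lambda>h. frechet_derivative f (at x) h + frechet_derivative g (at x) h)) (at x)"
    by (rule has_derivative_add) (use assms in \<open>simp_all add: frechet_derivative_works\<close>)
  then show ?thesis by (simp add: partial_deriv_eqI) (simp add: partial_deriv_def)
qed

lemma C_k_add:
  fixes f g :: "real^'n \<Rightarrow> 'b::real_normed_vector"
  shows "C_k k f \<Longrightarrow> C_k k g \<Longrightarrow> C_k k (\<lambda>x. f x + g x)"
proof (induction k arbitrary: f g)
  case 0
  then show ?case by (auto intro: continuous_on_add)
next
  case (Suc k)
  have "partial_deriv i (\<lambda>x. f x + g x) = (\<lambda>x. partial_deriv i f x + partial_deriv i g x)" for i
    using Suc.prems by (intro ext partial_deriv_add) auto
  then show ?case using Suc by (auto intro: differentiable_add)
qed

lemma partial_deriv_cmult: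
  fixes f :: "real^'n \<Rightarrow> complex"
  assumes "f differentiable (at x)"
  shows "partial_deriv i (\<lambda>x. c * f x) x = c * partial_deriv i f x"
proof -
  have "((\<lambda>x. c * f x) has_derivative (\<lambda>h. c * frechet_derivative f (at x) h)) (at x)"
    by (rule has_derivative_mult_right) (use assms in \<open>simp add: frechet_derivative_works\<close>)
  then show ?thesis by (simp add: partial_deriv_eqI) (simp add: partial_deriv_def)
qed

lemma C_k_cmult:
  fixes f :: "real^'n \<Rightarrow> complex"
  shows "C_k k f \<Longrightarrow> C_k k (\<lambda>x. c * f x)"
proof (induction k arbitrary: f)
  case 0
  then show ?case by (auto intro: continuous_intros)
next
  case (Suc k)
  have "partial_deriv i (\<lambda>x. c * f x) = (\<lambda>x. c * partial_deriv i f x)" for i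
    using Suc.prems by (intro ext partial_deriv_cmult) simp
  then show ?case using Suc by (auto intro: differentiable_mult)
qed

lemma C_k_zero: "C_k k (\<lambda>x :: real^'n. 0 :: 'b::real_normed_vector)"
proof (induction k)
  case (Suc k)
  have "partial_deriv i (\<lambda>x :: real^'n. 0 :: 'b) = (\<lambda>x. 0)" for i
    by (rule ext) (rule partial_deriv_eqI, simp)
  then show ?case using Suc by simp
qed simp

lemma test_function_iff: "test_function f \<longleftrightarrow> (\<forall>k. C_k k f) \<and> bounded {x. f x \<noteq> 0}"
  by (simp add: test_function_def compact_closure)

lemma test_function_bounded_support: "test_function f \<Longrightarrow> bounded {x. f x \<noteq> 0}"
  by (simp add: test_function_iff)

lemma test_function_C_1: "test_function f \<Longrightarrow> C_k 1 f"
  unfolding test_function_iff by blast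

lemma test_function_partial_C_1: "test_function f \<Longrightarrow> C_k 1 (partial_deriv i f)"
  unfolding test_function_iff using C_k.simps(2)[of 1 f] by blast

lemma test_function_zero: "test_function (\<lambda>x. 0)"
  by (simp add: test_function_iff C_k_zero)

lemma test_function_add:
  assumes "test_function f" "test_function g"
  shows "test_function (\<lambda>x. f x + g x)"
  unfolding test_function_iff
proof
  have "bounded ({x. f x \<noteq> 0} \<union> {x. g x \<noteq> 0})"
    using assms by (simp add: test_function_iff)
  then show "bounded {x. f x + g x \<noteq> 0}"
    by (rule bounded_subset) auto
qed (use assms in \<open>auto simp: test_function_iff intro: C_k_add\<close>)

lemma test_function_cmult:
  assumes "test_function f"
  shows "test_function (\<lambda>x. c * f x)"
  unfolding test_function_iff
proof
  show "bounded {x. c * f x \<noteq> 0}"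
    by (rule bounded_subset[OF test_function_bounded_support[OF assms]]) auto
qed (use assms in \<open>auto simp: test_function_iff intro: C_k_cmult\<close>)

lemma dirichlet_integrable:
  assumes a: "continuous_on UNIV a" and f: "test_function f" and g: "test_function g"
  shows "integrable lborel
    (\<lambda>x. of_real (a x) * (\<Sum>i\<in>UNIV. partial_deriv i f x * cnj (partial_deriv i g x)))"
proof (rule bounded_support_integrable)
  have "continuous_on UNIV (partial_deriv i f)" "continuous_on UNIV (partial_deriv i g)" for i
    using test_function_C_1[OF f] test_function_C_1[OF g] unfolding C_1_iff by auto
  then show "continuous_on UNIV
      (\<lambda>x. of_real (a x) * (\<Sum>i\<in>UNIV. partial_deriv i f x * cnj (partial_deriv i g x)))"
    by (intro continuous_intros a)
  have "{x. of_real (a x) * (\<Sum>i\<in>UNIV. partial_deriv i f x * cnj (partial_deriv i g x)) \<noteq> 0}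
      \<subseteq> (\<Union>i. {x. partial_deriv i f x \<noteq> 0})"
    by (auto, metis (no_types, lifting) mult_zero_left sum.neutral)
  then show "bounded
      {x. of_real (a x) * (\<Sum>i\<in>UNIV. partial_deriv i f x * cnj (partial_deriv i g x)) \<noteq> 0}"
    by (rule bounded_subset[rotated])
      (intro bounded_UN finite ballI bounded_support_partial_deriv test_function_bounded_support f)
qed

text \<open>Integration by parts: \<open>h\<close> is \<open>-\<nabla>\<cdot>(a\<nabla>g)\<close>, and each product \<open>f * cnj (a * \<partial>\<^sub>i g)\<close> is \<open>C\<^sup>1\<close> with
  compact support, so its \<open>i\<close>-th derivative integrates to zero.\<close>

lemma dirichlet_form_green:
  fixes a :: "real^'n \<Rightarrow> real"
  assumes a: "C_k 1 a" and f: "C_k 1 f" and g: "\<And>i. C_k 1 (partial_deriv i g)"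
    and supp: "bounded {x. g x \<noteq> 0}"
  defines "h \<equiv> \<lambda>x. - (\<Sum>i\<in>UNIV. partial_deriv i (\<lambda>x. a x *\<^sub>R partial_deriv i g x) x)"
  shows "sq_integrable h" and "dirichlet_form a f g = (\<integral>x. f x * cnj (h x) \<partial>lborel)"
proof -
  define G where "G i x = a x *\<^sub>R partial_deriv i g x" for i x
  have G1: "C_k 1 (G i)" for i
    unfolding G_def by (rule C_1_bilinear[OF bounded_bilinear_scaleR a g])
  have h: "h = (\<lambda>x. - (\<Sum>i\<in>UNIV. partial_deriv i (G i) x))" by (simp add: h_def G_def[abs_def])
  have Gs: "bounded {x. G i x \<noteq> 0}" for i
    by (rule bounded_subset[OF bounded_support_partial_deriv[OF supp, of i]]) (auto simp: G_def)
  have dGc: "continuous_on UNIV (partial_deriv i (G i))" for i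
    using G1 unfolding C_1_iff by blast
  have dGs: "bounded {x. partial_deriv i (G i) x \<noteq> 0}" for i
    by (rule bounded_support_partial_deriv[OF Gs])
  have "{x. h x \<noteq> 0} \<subseteq> (\<Union>i. {x. partial_deriv i (G i) x \<noteq> 0})"
    by (auto simp: h elim: sum.not_neutral_contains_not_neutral)
  then have hs: "bounded {x. h x \<noteq> 0}"
    by (rule bounded_subset[rotated]) (intro bounded_UN finite ballI dGs)
  have hc: "continuous_on UNIV h" unfolding h by (intro continuous_intros dGc)
  show "sq_integrable h" by (rule bounded_support_sq_integrable[OF hc hs])
  have fc: "continuous_on UNIV f" by (rule C_1_continuous[OF f])
  have dfc: "continuous_on UNIV (partial_deriv i f)" for i using f unfolding C_1_iff by blast
  have i1: "integrable lborel (\<lambda>x. f x * cnj (partial_deriv i (G i) x))" for i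
    by (rule bounded_support_integrable)
      (intro continuous_intros fc dGc, rule bounded_subset[OF dGs[of i]], auto)
  have i2: "integrable lborel (\<lambda>x. partial_deriv i f x * cnj (G i x))" for i
    by (rule bounded_support_integrable)
      (intro continuous_intros dfc C_1_continuous G1, rule bounded_subset[OF Gs[of i]], auto)
  have parts: "(\<integral>x. partial_deriv i f x * cnj (G i x) \<partial>lborel)
      = - (\<integral>x. f x * cnj (partial_deriv i (G i) x) \<partial>lborel)" for i
  proof -
    have "(\<integral>x. partial_deriv i (\<lambda>x. f x * cnj (G i x)) x \<partial>lborel) = 0"
      by (rule integral_partial_deriv_eq_0[OF C_1_bilinear[OF bounded_bilinear_mult_cnj f G1]])
        (rule bounded_subset[OF Gs[of i]], auto)
    moreover have "partial_deriv i (\<lambda>x. f x * cnj (G i x)) x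
        = f x * cnj (partial_deriv i (G i) x) + partial_deriv i f x * cnj (G i x)" for x
      by (rule partial_deriv_bilinear[OF bounded_bilinear_mult_cnj])
        (use f G1 in \<open>auto simp: C_1_iff\<close>)
    ultimately show ?thesis using i1 i2 by (simp add: eq_neg_iff_add_eq_0 add.commute)
  qed
  have "dirichlet_form a f g = (\<integral>x. (\<Sum>i\<in>UNIV. partial_deriv i f x * cnj (G i x)) \<partial>lborel)"
    unfolding dirichlet_form_def G_def
    by (simp add: sum_distrib_left scaleR_conv_of_real mult.left_commute)
  also have "\<dots> = (\<Sum>i\<in>UNIV. - (\<integral>x. f x * cnj (partial_deriv i (G i) x) \<partial>lborel))"
    by (simp add: i2 parts)
  also have "\<dots> = (\<integral>x. f x * cnj (h x) \<partial>lborel)"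
    using i1 by (simp add: h sum_distrib_left sum_negf)
  finally show "dirichlet_form a f g = (\<integral>x. f x * cnj (h x) \<partial>lborel)" .
qed

lemma dirichlet_l2_abs_l2:
  "test_function f \<Longrightarrow> test_function g \<Longrightarrow>
    dirichlet_l2 a (abs_l2 f) (abs_l2 g) = dirichlet_form a f g"
  by (simp add: dirichlet_l2_def test_rep_abs_l2)

lemma symmetric_form_dirichlet:
  fixes a :: "real^'n \<Rightarrow> real"
  assumes a: "C_k 1 a" and pos: "\<And>x. 0 \<le> a x"
  shows "symmetric_form test_l2 (dirichlet_l2 a)"
proof
  note sq = test_function_sq_integrable
  have ac: "continuous_on UNIV a" by (rule C_1_continuous[OF a])
  have diff: "f differentiable (at x)" if "test_function f" for f :: "real^'n \<Rightarrow> complex" and x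
    using test_function_C_1[OF that] unfolding C_1_iff by blast
  have "(0 :: 'n l2) = abs_l2 (\<lambda>x. 0)" by (rule zero_l2.abs_eq)
  then show "(0 :: 'n l2) \<in> test_l2" using test_function_zero unfolding test_l2_def by blast
  fix u v w :: "'n l2" and c
  assume "u \<in> test_l2" then obtain f where f: "test_function f" "u = abs_l2 f"
    unfolding test_l2_def by blast
  show "scaleC_l2 c u \<in> test_l2"
    using test_function_cmult[OF f(1), of c] abs_l2_scaleC[OF sq[OF f(1)], of c] f(2)
    unfolding test_l2_def by blast
  show "0 \<le> Re (dirichlet_l2 a u u)"
    unfolding f(2) dirichlet_l2_abs_l2[OF f(1) f(1)] dirichlet_form_diag
    by (simp add: pos sum_nonneg)
  assume "v \<in> test_l2" then obtain g where g: "test_function g" "v = abs_l2 g"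
    unfolding test_l2_def by blast
  show "u + v \<in> test_l2"
    using test_function_add[OF f(1) g(1)] abs_l2_add[OF sq[OF f(1)] sq[OF g(1)]] f(2) g(2)
    unfolding test_l2_def by blast
  show "dirichlet_l2 a (scaleC_l2 c u) v = c * dirichlet_l2 a u v"
    by (simp add: f(2) g(2) abs_l2_scaleC sq f(1) dirichlet_l2_abs_l2 test_function_cmult g(1)
        dirichlet_form_def partial_deriv_cmult diff mult.assoc mult.left_commute[of _ c]
        sum_distrib_left[of c, symmetric])
  show "dirichlet_l2 a v u = cnj (dirichlet_l2 a u v)"
    by (simp add: f g dirichlet_l2_abs_l2 dirichlet_form_def mult.commute
        Bochner_Integration.integral_cnj[symmetric] del: Bochner_Integration.integral_cnj)
  show "\<exists>h. \<forall>u\<in>test_l2. dirichlet_l2 a u v = cinner_l2 u h"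
  proof (intro exI ballI)
    let ?h = "\<lambda>x. - (\<Sum>i\<in>UNIV. partial_deriv i (\<lambda>x. a x *\<^sub>R partial_deriv i g x) x)"
    fix u :: "'n l2" assume "u \<in> test_l2"
    then obtain f where f: "test_function f" "u = abs_l2 f" unfolding test_l2_def by blast
    note green = dirichlet_form_green[OF a test_function_C_1[OF f(1)]
        test_function_partial_C_1[OF g(1)] test_function_bounded_support[OF g(1)]]
    show "dirichlet_l2 a u v = cinner_l2 u (abs_l2 ?h)"
      unfolding f(2) g(2) dirichlet_l2_abs_l2[OF f(1) g(1)] cinner_abs_l2[OF sq[OF f(1)] green(1)]
      by (rule green(2))
  qed
  assume "w \<in> test_l2" then obtain k where k: "test_function k" "w = abs_l2 k"
    unfolding test_l2_def by blast
  have "partial_deriv i (\<lambda>x. f x + g x) x = partial_deriv i f x + partial_deriv i g x" for i x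
    by (rule partial_deriv_add) (auto intro: diff f g)
  then have "dirichlet_form a (\<lambda>x. f x + g x) k = dirichlet_form a f k + dirichlet_form a g k"
    using dirichlet_integrable[OF ac f(1) k(1)] dirichlet_integrable[OF ac g(1) k(1)]
    by (simp add: dirichlet_form_def distrib_left distrib_right sum.distrib)
  then show "dirichlet_l2 a (u + v) w = dirichlet_l2 a u w + dirichlet_l2 a v w"
    by (simp add: f g k abs_l2_add sq dirichlet_l2_abs_l2 test_function_add)
qed

section \<open>Translation continuity of the resolvent\<close>

theorem theorem2:
  fixes a :: "real^'n \<Rightarrow> real" and \<alpha> :: real
  assumes "C_k 1 a" and "\<forall>x. a x > 0"
    and "\<exists>c>0. \<forall>x. c \<le> a x"
    and "\<alpha> > 0"
  shows "let A = op_inverse (plus_scalar (friedrichs a) \<alpha>) in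
    is_bounded_inverse (plus_scalar (friedrichs a) \<alpha>) A \<and>
    ((\<lambda>s. onorm (\<lambda>f. translate_l2 s (A f) - A f)) \<longlongrightarrow> 0) (at 0) \<and>
    ((\<lambda>s. onorm (\<lambda>f. translate_l2 s (adjoint_l2 A f) - adjoint_l2 A f)) \<longlongrightarrow> 0) (at 0)"
proof -
  define A where "A = op_inverse (plus_scalar (friedrichs a) \<alpha>)"
  obtain c where c: "c > 0" "\<And>x. c \<le> a x" using assms(3) by blast
  interpret symmetric_form test_l2 "dirichlet_l2 a"
    by (rule symmetric_form_dirichlet) (use assms in \<open>auto intro: less_imp_le\<close>)
  have inv: "is_bounded_inverse (plus_scalar (friedrichs a) \<alpha>) A"
    unfolding A_def friedrichs_def by (rule resolvent_is_bounded_inverse[OF assms(4)])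
  have adj: "adjoint_l2 A = A"
    unfolding A_def friedrichs_def by (rule adjoint_resolvent[OF assms(4)])
  have T: "bounded_linear (\<lambda>u. translate_l2 s u - u)" for s :: "real^'n"
    by (intro bounded_linear_sub bounded_linear_translate_l2 bounded_linear_ident)
  have core: "norm (translate_l2 s u - u) \<le> norm s / sqrt c * sqrt (Re (dirichlet_l2 a u u))"
    if "u \<in> test_l2" for s :: "real^'n" and u
  proof -
    obtain f where f: "test_function f" "u = abs_l2 f" using \<open>u \<in> test_l2\<close> unfolding test_l2_def by blast
    show ?thesis
      unfolding f(2) dirichlet_l2_abs_l2[OF f(1) f(1)]
      by (rule norm_translate_diff_le_dirichlet[OF test_function_C_1[OF f(1)]
            test_function_bounded_support[OF f(1)] C_1_continuous[OF assms(1)] c])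
  qed
  have le: "onorm (\<lambda>f. translate_l2 s (A f) - A f) \<le> norm s / sqrt c / sqrt \<alpha>" for s
    unfolding A_def friedrichs_def
    by (rule onorm_comp_resolvent_le[OF T _ assms(4) core]) (use c in simp)
  have ge: "0 \<le> onorm (\<lambda>f. translate_l2 s (A f) - A f)" for s
    by (rule onorm_pos_le, rule bounded_linear_compose[OF T])
      (use inv in \<open>simp add: is_bounded_inverse_def\<close>)
  have "((\<lambda>s :: real^'n. norm s / sqrt c / sqrt \<alpha>) \<longlongrightarrow> norm (0 :: real^'n) / sqrt c / sqrt \<alpha>) (at 0)"
    by (intro tendsto_intros) (use c assms(4) in auto)
  then have "((\<lambda>s :: real^'n. norm s / sqrt c / sqrt \<alpha>) \<longlongrightarrow> 0) (at 0)" by simp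
  then have "((\<lambda>s. onorm (\<lambda>f. translate_l2 s (A f) - A f)) \<longlongrightarrow> 0) (at 0)"
    by (rule tendsto_sandwich[OF always_eventually always_eventually tendsto_const, rotated 2])
      (use le ge in blast)+
  then show ?thesis
    using inv adj by (simp add: Let_def A_def[symmetric])
qed

end
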